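(* Let $\Gamma$ be a finitely generated group, $S=S^{-1}\subset\Gamma$ a finite generating set and $\Delta=|S|\cdot\mathbf{1}-\sum_{s\in S}s\in\mathbb{R}[\Gamma]$ the corresponding Laplacian. Let $\mathcal{C}$ denote the collection of all 1-cocycles $c\colon\Gamma\to\mathcal{H}$, for arbitrary orthogonal representations of $\Gamma$ on real Hilbert spaces $\mathcal{H}$, that satisfy $\sum_{s\in S}\|c(s)\|^2=2$. Then the infimum $\inf_{c\in\mathcal{C}}\big\|\sum_{s\in S}c(s)\big\|^2$ is assumed (attained by some $c\in\mathcal{C}$) and agrees with the size of the spectral gap of $\Delta$ above $0$.
   Context: $\mathbf{1}$ denotes the neutral element of $\Gamma$. A 1-cocycle for an orthogonal representation $\pi$ of $\Gamma$ on a real Hilbert space $\mathcal{H}$ is a map $c\colon\Gamma\to\mathcal{H}$ with $c(\mathbf{1})=0$ and $c(\gamma_1\gamma_2)=c(\gamma_1)+\pi(\gamma_1)c(\gamma_2)$ for all $\gamma_1,\gamma_2\in\Gamma$. The Laplacian $\Delta$ is regarded as a positive element of the maximal group $\mathrm{C}^*$-algebra $\mathrm{C}^*_{\mathrm{max}}(\Gamma)$; the size of its spectral gap above $0$ is the supremum of all $\varepsilon\ge 0$ such that the spectrum of $\Delta$ in $\mathrm{C}^*_{\mathrm{max}}(\Gamma)$ does not meet the open interval $(0,\varepsilon)$ (so it equals $0$ if there is no gap).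
   Formalization: That the infimum is attained is claimed only for nontrivial Γ: for the trivial group every cocycle is zero, so 𝒞 is empty and nothing attains it; the equality with the gap still holds there, both sides being +∞. *)

theory Defs
  imports "HOL-Analysis.Analysis" "HOL-Algebra.Generated_Groups" "HOL-Algebra.Module"
begin

section \<open>The Hilbert space of square-summable sequences\<close>

text \<open>Used below with \<^typ>\<open>real\<close> and \<^typ>\<open>complex\<close> as the coefficient type \<open>'a\<close>.  The inner
  product is always the real one, which for \<open>'a = complex\<close> is the real part of the Hermitian one.\<close>

typedef (overloaded) ('a::real_inner) ell2 = "{x :: nat \<Rightarrow> 'a. summable (\<lambda>n. (norm (x n))\<^sup>2)}"
  morphisms seq Abs_ell2
proof
  show "(\<lambda>_. 0) \<in> {x :: nat \<Rightarrow> 'a. summable (\<lambda>n. (norm (x n))\<^sup>2)}" by simp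
qed

setup_lifting type_definition_ell2

lemma square_summable_add:
  fixes x y :: "nat \<Rightarrow> 'a::real_inner"
  assumes "summable (\<lambda>n. (norm (x n))\<^sup>2)" "summable (\<lambda>n. (norm (y n))\<^sup>2)"
  shows "summable (\<lambda>n. (norm (x n + y n))\<^sup>2)"
proof (rule summable_comparison_test')
  show "summable (\<lambda>n. 2 * (norm (x n))\<^sup>2 + 2 * (norm (y n))\<^sup>2)"
    using assms by (intro summable_add summable_mult)
  fix n
  have "(norm (x n + y n))\<^sup>2 \<le> (norm (x n) + norm (y n))\<^sup>2"
    by (intro power_mono norm_triangle_ineq) auto
  also have "\<dots> \<le> 2 * (norm (x n))\<^sup>2 + 2 * (norm (y n))\<^sup>2"
    using sum_squares_bound[of "norm (x n)" "norm (y n)"] by (simp add: power2_sum)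
  finally show "norm ((norm (x n + y n))\<^sup>2) \<le> 2 * (norm (x n))\<^sup>2 + 2 * (norm (y n))\<^sup>2" by simp
qed

lemma square_summable_inner:
  fixes x y :: "nat \<Rightarrow> 'a::real_inner"
  assumes "summable (\<lambda>n. (norm (x n))\<^sup>2)" "summable (\<lambda>n. (norm (y n))\<^sup>2)"
  shows "summable (\<lambda>n. inner (x n) (y n))"
proof (rule summable_comparison_test')
  show "summable (\<lambda>n. (norm (x n))\<^sup>2 + (norm (y n))\<^sup>2)"
    using assms by (intro summable_add)
  fix n
  have "\<bar>inner (x n) (y n)\<bar> \<le> norm (x n) * norm (y n)"
    by (rule Cauchy_Schwarz_ineq2)
  also have "\<dots> \<le> 2 * (norm (x n) * norm (y n))" by simp
  also have "\<dots> \<le> (norm (x n))\<^sup>2 + (norm (y n))\<^sup>2"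
    using sum_squares_bound[of "norm (x n)" "norm (y n)"] by (simp add: mult.assoc)
  finally show "norm (inner (x n) (y n)) \<le> (norm (x n))\<^sup>2 + (norm (y n))\<^sup>2" by simp
qed

instantiation ell2 :: (real_inner) real_inner
begin

lift_definition zero_ell2 :: "'a ell2" is "\<lambda>_. 0" by simp
lift_definition plus_ell2 :: "'a ell2 \<Rightarrow> 'a ell2 \<Rightarrow> 'a ell2" is "\<lambda>x y n. x n + y n"
  by (rule square_summable_add)
lift_definition uminus_ell2 :: "'a ell2 \<Rightarrow> 'a ell2" is "\<lambda>x n. - x n" by simp
lift_definition minus_ell2 :: "'a ell2 \<Rightarrow> 'a ell2 \<Rightarrow> 'a ell2" is "\<lambda>x y n. x n - y n"
  subgoal for x y using square_summable_add[of x "\<lambda>n. - y n"] by simp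
  done
lift_definition scaleR_ell2 :: "real \<Rightarrow> 'a ell2 \<Rightarrow> 'a ell2" is "\<lambda>r x n. r *\<^sub>R x n"
  by (simp add: power_mult_distrib summable_mult)
lift_definition inner_ell2 :: "'a ell2 \<Rightarrow> 'a ell2 \<Rightarrow> real" is "\<lambda>x y. \<Sum>n. inner (x n) (y n)" .

definition norm_ell2 :: "'a ell2 \<Rightarrow> real" where "norm_ell2 x = sqrt (inner x x)"
definition sgn_ell2 :: "'a ell2 \<Rightarrow> 'a ell2" where "sgn_ell2 x = inverse (norm x) *\<^sub>R x"
definition dist_ell2 :: "'a ell2 \<Rightarrow> 'a ell2 \<Rightarrow> real" where "dist_ell2 x y = norm (x - y)"
definition uniformity_ell2 :: "('a ell2 \<times> 'a ell2) filter" where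
  "uniformity_ell2 = (INF e\<in>{0 <..}. principal {(x, y). dist x y < e})"
definition open_ell2 :: "'a ell2 set \<Rightarrow> bool" where
  "open_ell2 U \<longleftrightarrow> (\<forall>x\<in>U. eventually (\<lambda>(x', y). x' = x \<longrightarrow> y \<in> U) uniformity)"

instance
proof
  fix x y z :: "'a ell2" and a b r :: real
  show "x + y + z = x + (y + z)" "x + y = y + x" "0 + x = x" "- x + x = 0" "x - y = x + - y"
    "1 *\<^sub>R x = x" "a *\<^sub>R b *\<^sub>R x = (a * b) *\<^sub>R x"
    by (transfer; simp add: algebra_simps fun_eq_iff)+
  show "a *\<^sub>R (x + y) = a *\<^sub>R x + a *\<^sub>R y" "(a + b) *\<^sub>R x = a *\<^sub>R x + b *\<^sub>R x"
    by (transfer; simp add: scaleR_add_right scaleR_add_left)+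
  show "inner x y = inner y x"
    by transfer (simp add: inner_commute)
  show "inner (x + y) z = inner x z + inner y z"
    by transfer (simp add: inner_add_left suminf_add square_summable_inner)
  show "inner (r *\<^sub>R x) y = r * inner x y"
    by transfer (simp add: suminf_mult square_summable_inner)
  show "0 \<le> inner x x"
    by transfer (auto intro!: suminf_nonneg simp: square_summable_inner)
  show "inner x x = 0 \<longleftrightarrow> x = 0"
    by transfer (simp add: suminf_eq_zero_iff square_summable_inner fun_eq_iff)
qed (rule norm_ell2_def sgn_ell2_def dist_ell2_def uniformity_ell2_def open_ell2_def)+

end

lemma norm_ell2_square: "(norm (x :: 'a::real_inner ell2))\<^sup>2 = (\<Sum>n. (norm (seq x n))\<^sup>2)"
  by (simp add: power2_norm_eq_inner inner_ell2.rep_eq)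

lemma summable_seq: "summable (\<lambda>n. (norm (seq x n))\<^sup>2)"
  using seq[of x] by simp

lemma norm_seq_le: "norm (seq x n) \<le> norm x"
proof (rule power2_le_imp_le)
  show "(norm (seq x n))\<^sup>2 \<le> (norm x)\<^sup>2"
    unfolding norm_ell2_square
    using sum_le_suminf[OF summable_seq, of "{n}" x] by simp
qed simp

instance ell2 :: ("{real_inner, complete_space}") complete_space
proof
  fix X :: "nat \<Rightarrow> 'a ell2"
  assume X: "Cauchy X"
  have seq_diff: "seq (x - y) n = seq x n - seq y n" for x y :: "'a ell2" and n
    by transfer simp
  have "Cauchy (\<lambda>k. seq (X k) n)" for n
  proof (rule metric_CauchyI)
    fix e :: real assume "e > 0"
    then obtain M where "\<And>j k. j \<ge> M \<Longrightarrow> k \<ge> M \<Longrightarrow> dist (X j) (X k) < e"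
      using X metric_CauchyD by blast
    then show "\<exists>M. \<forall>j\<ge>M. \<forall>k\<ge>M. dist (seq (X j) n) (seq (X k) n) < e"
      unfolding dist_norm seq_diff[symmetric] using norm_seq_le order.strict_trans1 by blast
  qed
  then have "\<exists>l. (\<lambda>k. seq (X k) n) \<longlonglongrightarrow> l" for n
    by (simp add: Cauchy_convergent_iff convergent_def)
  then obtain l where l: "\<And>n. (\<lambda>k. seq (X k) n) \<longlonglongrightarrow> l n" by metis
  have tail: "\<exists>M. \<forall>k\<ge>M. summable (\<lambda>n. (norm (seq (X k) n - l n))\<^sup>2) \<and>
      (\<Sum>n. (norm (seq (X k) n - l n))\<^sup>2) \<le> e\<^sup>2" if "e > 0" for e
  proof -
    obtain M where M: "\<And>j k. j \<ge> M \<Longrightarrow> k \<ge> M \<Longrightarrow> dist (X j) (X k) < e"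
      using X metric_CauchyD \<open>e > 0\<close> by blast
    have part: "(\<Sum>n<N. (norm (seq (X k) n - l n))\<^sup>2) \<le> e\<^sup>2" if "k \<ge> M" for k N
    proof (rule LIMSEQ_le_const2)
      show "(\<lambda>j. \<Sum>n<N. (norm (seq (X k) n - seq (X j) n))\<^sup>2)
          \<longlonglongrightarrow> (\<Sum>n<N. (norm (seq (X k) n - l n))\<^sup>2)"
        by (intro tendsto_intros l)
      have "(\<Sum>n<N. (norm (seq (X k) n - seq (X j) n))\<^sup>2) \<le> e\<^sup>2" if "j \<ge> M" for j
      proof -
        have "(\<Sum>n<N. (norm (seq (X k) n - seq (X j) n))\<^sup>2) \<le> (norm (X k - X j))\<^sup>2"
          unfolding norm_ell2_square seq_diff[symmetric]
          by (intro sum_le_suminf summable_seq) auto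
        also have "\<dots> \<le> e\<^sup>2"
          using M[OF \<open>k \<ge> M\<close> \<open>j \<ge> M\<close>] by (intro power_mono) (auto simp: dist_norm)
        finally show ?thesis .
      qed
      then show "\<exists>M. \<forall>j\<ge>M. (\<Sum>n<N. (norm (seq (X k) n - seq (X j) n))\<^sup>2) \<le> e\<^sup>2" by blast
    qed
    have "summable (\<lambda>n. (norm (seq (X k) n - l n))\<^sup>2) \<and>
        (\<Sum>n. (norm (seq (X k) n - l n))\<^sup>2) \<le> e\<^sup>2" if "k \<ge> M" for k
    proof -
      have "summable (\<lambda>n. (norm (seq (X k) n - l n))\<^sup>2)"
        using part[OF that] by (intro summableI_nonneg_bounded) auto
      then show ?thesis
        using part[OF that] by (auto intro!: suminf_le_const)
    qed
    then show ?thesis by blast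
  qed
  obtain M where "summable (\<lambda>n. (norm (seq (X M) n - l n))\<^sup>2)"
    using tail[of 1] by auto
  from square_summable_add[OF summable_seq[of "X M"], of "\<lambda>n. - (seq (X M) n - l n)"] this
  have "summable (\<lambda>n. (norm (l n))\<^sup>2)"
    by (simp add: norm_minus_commute)
  then have L: "seq (Abs_ell2 l) = l" by (simp add: Abs_ell2_inverse)
  have "X \<longlonglongrightarrow> Abs_ell2 l"
  proof (rule metric_LIMSEQ_I)
    fix e :: real assume "e > 0"
    then obtain M where M: "\<And>k. k \<ge> M \<Longrightarrow> (\<Sum>n. (norm (seq (X k) n - l n))\<^sup>2) \<le> (e / 2)\<^sup>2"
      using tail[of "e / 2"] by auto
    have "dist (X k) (Abs_ell2 l) < e" if "k \<ge> M" for k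
    proof -
      have "(norm (X k - Abs_ell2 l))\<^sup>2 \<le> (e / 2)\<^sup>2"
        using M[OF that] by (simp only: norm_ell2_square seq_diff L)
      then have "norm (X k - Abs_ell2 l) \<le> e / 2"
        by (rule power2_le_imp_le) (use \<open>e > 0\<close> in simp)
      then show ?thesis using \<open>e > 0\<close> by (simp add: dist_norm)
    qed
    then show "\<exists>M. \<forall>k\<ge>M. dist (X k) (Abs_ell2 l) < e" by blast
  qed
  then show "convergent X" by (auto simp: convergent_def)
qed

lift_definition cscale :: "complex \<Rightarrow> complex ell2 \<Rightarrow> complex ell2" is "\<lambda>z x n. z * x n"
  by (simp add: norm_mult power_mult_distrib summable_mult)

lemma norm_cscale: "norm (cscale z x) = cmod z * norm x"
proof -
  have "(norm (cscale z x))\<^sup>2 = (cmod z * norm x)\<^sup>2"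
    unfolding norm_ell2_square power_mult_distrib
    by (simp add: cscale.rep_eq norm_mult power_mult_distrib suminf_mult summable_seq)
  then show ?thesis by (simp add: power2_eq_iff_nonneg)
qed

lift_definition cscalar :: "complex \<Rightarrow> complex ell2 \<Rightarrow>\<^sub>L complex ell2" is cscale
proof
  fix z r and x y :: "complex ell2"
  show "cscale z (x + y) = cscale z x + cscale z y"
    by transfer (simp add: algebra_simps)
  show "cscale z (r *\<^sub>R x) = r *\<^sub>R cscale z x"
    by transfer simp
  show "\<exists>K. \<forall>x. norm (cscale z x) \<le> norm x * K"
    by (rule exI[of _ "cmod z"]) (simp add: norm_cscale)
qed


section \<open>Representations and cocycles\<close>

definition orthogonal_rep ::
  "('g, 'm) monoid_scheme \<Rightarrow> ('g \<Rightarrow> 'h::{real_inner, complete_space} \<Rightarrow>\<^sub>L 'h) \<Rightarrow> bool" where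
  "orthogonal_rep G \<pi> \<longleftrightarrow>
     \<pi> \<one>\<^bsub>G\<^esub> = id_blinfun \<and>
     (\<forall>g\<in>carrier G. \<forall>h\<in>carrier G. \<pi> (g \<otimes>\<^bsub>G\<^esub> h) = \<pi> g o\<^sub>L \<pi> h) \<and>
     (\<forall>g\<in>carrier G. orthogonal_transformation (blinfun_apply (\<pi> g)))"

definition cocycle ::
  "('g, 'm) monoid_scheme \<Rightarrow> ('g \<Rightarrow> 'h::{real_inner, complete_space} \<Rightarrow>\<^sub>L 'h) \<Rightarrow> ('g \<Rightarrow> 'h) \<Rightarrow> bool"
  where
  "cocycle G \<pi> c \<longleftrightarrow>
     c \<one>\<^bsub>G\<^esub> = 0 \<and>
     (\<forall>g\<in>carrier G. \<forall>h\<in>carrier G. c (g \<otimes>\<^bsub>G\<^esub> h) = c g + \<pi> g (c h))"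

text \<open>HOL cannot quantify over the Hilbert space \<open>'h\<close> inside a formula.  For a countable group the
  values of a cocycle span a separable space, so the infimum over all real Hilbert spaces is already
  the one over \<^typ>\<open>real ell2\<close>; a lower bound for all spaces is stated with \<open>'h\<close> schematic.\<close>

definition normalized_cocycles ::
  "('g, 'm) monoid_scheme \<Rightarrow> 'g set \<Rightarrow> ('g \<Rightarrow> 'h::{real_inner, complete_space}) set" where
  "normalized_cocycles G S =
     {c. (\<exists>\<pi>. orthogonal_rep G \<pi> \<and> cocycle G \<pi> c) \<and> (\<Sum>s\<in>S. (norm (c s))\<^sup>2) = 2}"


section \<open>The maximal group C*-algebra\<close>

definition group_algebra :: "('g, 'm) monoid_scheme \<Rightarrow> ('g \<Rightarrow> complex) set" where
  "group_algebra G = {f. finite {g. f g \<noteq> 0} \<and> {g. f g \<noteq> 0} \<subseteq> carrier G}"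

type_synonym operator = "complex ell2 \<Rightarrow>\<^sub>L complex ell2"

text \<open>An orthogonal complex-linear operator preserves the Hermitian inner product, since its real
  part determines it; it is onto because \<open>U g\<close> is invertible.\<close>

definition unitary_rep :: "('g, 'm) monoid_scheme \<Rightarrow> ('g \<Rightarrow> operator) \<Rightarrow> bool" where
  "unitary_rep G U \<longleftrightarrow>
     orthogonal_rep G U \<and> (\<forall>g\<in>carrier G. \<forall>z. U g o\<^sub>L cscalar z = cscalar z o\<^sub>L U g)"

definition extend_rep :: "('g \<Rightarrow> operator) \<Rightarrow> ('g \<Rightarrow> complex) \<Rightarrow> operator" where
  "extend_rep U f = (\<Sum>g | f g \<noteq> 0. cscalar (f g) o\<^sub>L U g)"

text \<open>The universal representation: \<open>f\<close> is sent to the family of its images under all unitary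
  representations.  For countable \<open>G\<close> every cyclic representation lives on a separable space and,
  after adding an infinite-dimensional trivial summand, on \<^typ>\<open>complex ell2\<close>; the trivial
  representation is itself included.  So the supremum over \<open>U\<close> of the operator norms of the
  components is the maximal C*-norm of \<open>f\<close>.  Off the set of unitary representations the families
  are \<open>0\<close> by convention.\<close>

definition universal_rep ::
  "('g, 'm) monoid_scheme \<Rightarrow> ('g \<Rightarrow> complex) \<Rightarrow> ('g \<Rightarrow> operator) \<Rightarrow> operator" where
  "universal_rep G f = (\<lambda>U. if unitary_rep G U then extend_rep U f else 0)"

text \<open>The completion of the group algebra in the maximal norm, realised as the uniform closure of
  its image under the (isometric) universal representation, with componentwise operations.\<close>

definition cstar_max ::
  "('g, 'm) monoid_scheme \<Rightarrow> (complex, ('g \<Rightarrow> operator) \<Rightarrow> operator) module" where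
  "cstar_max G =
     \<lparr>carrier = {a. \<forall>e>0. \<exists>f\<in>group_algebra G. \<forall>U. norm (a U - universal_rep G f U) \<le> e},
      mult = (\<lambda>a b U. a U o\<^sub>L b U),
      one = (\<lambda>U. if unitary_rep G U then id_blinfun else 0),
      zero = (\<lambda>U. 0),
      add = (\<lambda>a b U. a U + b U),
      smult = (\<lambda>z a U. cscalar z o\<^sub>L a U)\<rparr>"

subsection \<open>The maximal group C*-algebra is a ring\<close>

lemma cscalar_zero: "cscalar 0 = 0"
  by (rule blinfun_eqI, simp add: cscalar.rep_eq, transfer) simp

lemma id_blinfun_compose: "id_blinfun o\<^sub>L a = a" and compose_id_blinfun: "a o\<^sub>L id_blinfun = a"
  by (auto intro: blinfun_eqI)

lemma extend_rep_superset:
  assumes "finite B" "{g. f g \<noteq> 0} \<subseteq> B"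
  shows "extend_rep U f = (\<Sum>g\<in>B. cscalar (f g) o\<^sub>L U g)"
proof -
  show ?thesis
    unfolding extend_rep_def using assms by (intro sum.mono_neutral_left) (auto simp: cscalar_zero)
qed

lemma cscalar_add: "cscalar (w + z) = cscalar w + cscalar z"
  by (rule blinfun_eqI, simp add: blinfun.add_left cscalar.rep_eq, transfer)
    (simp add: algebra_simps)

lemma cscalar_mult: "cscalar (w * z) = cscalar w o\<^sub>L cscalar z"
  by (rule blinfun_eqI, simp add: cscalar.rep_eq, transfer) (simp add: algebra_simps)

lemma cscalar_one: "cscalar 1 = id_blinfun"
  by (rule blinfun_eqI, simp add: cscalar.rep_eq, transfer) simp

lemma blinfun_compose_assoc: "(a o\<^sub>L b) o\<^sub>L c = a o\<^sub>L (b o\<^sub>L c)"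
  by (rule blinfun_eqI) simp

lemma extend_rep_add:
  assumes "f \<in> group_algebra G" "f' \<in> group_algebra G"
  shows "extend_rep U (\<lambda>g. f g + f' g) = extend_rep U f + extend_rep U f'"
proof -
  let ?B = "{g. f g \<noteq> 0} \<union> {g. f' g \<noteq> 0}"
  have B: "finite ?B" using assms by (auto simp: group_algebra_def)
  show ?thesis
    by (subst (1 2 3) extend_rep_superset[OF B])
      (auto simp: cscalar_add sum.distrib
        bounded_bilinear.add_left[OF bounded_bilinear_blinfun_compose])
qed

lemma extend_rep_mult:
  fixes f f' :: "'a \<Rightarrow> complex"
  assumes G: "group G" and f: "f \<in> group_algebra G" and f': "f' \<in> group_algebra G"
  shows "\<exists>k\<in>group_algebra G. \<forall>U. unitary_rep G U \<longrightarrow> extend_rep U k = extend_rep U f o\<^sub>L extend_rep U f'"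
proof -
  interpret group G by fact
  let ?A = "{g. f g \<noteq> 0}" and ?B = "{g. f' g \<noteq> 0}"
  let ?m = "\<lambda>(g, h). g \<otimes>\<^bsub>G\<^esub> h"
  let ?k = "\<lambda>x. \<Sum>p\<in>{p \<in> ?A \<times> ?B. ?m p = x}. f (fst p) * f' (snd p)"
  have fin: "finite ?A" "finite ?B" and sub: "?A \<subseteq> carrier G" "?B \<subseteq> carrier G"
    using f f' by (auto simp: group_algebra_def)
  have supp: "{x. ?k x \<noteq> 0} \<subseteq> ?m ` (?A \<times> ?B)"
  proof
    fix x assume "x \<in> {x. ?k x \<noteq> 0}"
    then have "{p \<in> ?A \<times> ?B. ?m p = x} \<noteq> {}" by (metis (mono_tags, lifting) mem_Collect_eq sum.empty)
    then show "x \<in> ?m ` (?A \<times> ?B)" by blast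
  qed
  have im: "finite (?m ` (?A \<times> ?B))" "?m ` (?A \<times> ?B) \<subseteq> carrier G"
    using fin sub by auto
  have "?k \<in> group_algebra G"
    using supp im by (auto simp: group_algebra_def intro: finite_subset)
  moreover have "extend_rep U ?k = extend_rep U f o\<^sub>L extend_rep U f'" if U: "unitary_rep G U" for U
  proof -
    interpret c: bounded_bilinear "(o\<^sub>L) :: operator \<Rightarrow> operator \<Rightarrow> operator"
      by (rule bounded_bilinear_blinfun_compose)
    have [simp]: "cscalar (sum F I) = (\<Sum>i\<in>I. cscalar (F i))" for F :: "'a \<times> 'a \<Rightarrow> complex" and I
    proof (induction I rule: infinite_finite_induct)
      case (insert x I) then show ?case by (simp add: cscalar_add)
    qed (simp_all add: cscalar_zero)
    have cc: "(cscalar (f g) o\<^sub>L U g) o\<^sub>L (cscalar (f' h) o\<^sub>L U h)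
        = cscalar (f g * f' h) o\<^sub>L U (g \<otimes>\<^bsub>G\<^esub> h)" if "g \<in> ?A" "h \<in> ?B" for g h
    proof -
      have "g \<in> carrier G" "h \<in> carrier G" using that sub by auto
      then have "U g o\<^sub>L cscalar (f' h) = cscalar (f' h) o\<^sub>L U g" "U (g \<otimes>\<^bsub>G\<^esub> h) = U g o\<^sub>L U h"
        using U by (auto simp: unitary_rep_def orthogonal_rep_def)
      then show ?thesis
        by (simp add: cscalar_mult blinfun_compose_assoc) (metis blinfun_compose_assoc)
    qed
    have "extend_rep U ?k = (\<Sum>x\<in>?m ` (?A \<times> ?B). cscalar (?k x) o\<^sub>L U x)"
      by (rule extend_rep_superset[OF im(1) supp])
    also have "\<dots> = (\<Sum>x\<in>?m ` (?A \<times> ?B). \<Sum>p\<in>{p \<in> ?A \<times> ?B. ?m p = x}.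
        cscalar (f (fst p) * f' (snd p)) o\<^sub>L U (?m p))"
      by (auto simp: c.sum_left intro!: sum.cong)
    also have "\<dots> = (\<Sum>p\<in>?A \<times> ?B. cscalar (f (fst p) * f' (snd p)) o\<^sub>L U (?m p))"
      using fin im by (intro sum.group) auto
    also have "\<dots> = (\<Sum>(g, h)\<in>?A \<times> ?B. (cscalar (f g) o\<^sub>L U g) o\<^sub>L (cscalar (f' h) o\<^sub>L U h))"
      by (intro sum.cong) (auto simp: cc)
    also have "\<dots> = extend_rep U f o\<^sub>L extend_rep U f'"
      unfolding extend_rep_def c.sum_left unfolding c.sum_right sum.cartesian_product ..
    finally show ?thesis .
  qed
  ultimately show ?thesis by blast
qed


lemma group_algebra_add:
  assumes "f \<in> group_algebra G" "f' \<in> group_algebra G"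
  shows "(\<lambda>g. f g + f' g) \<in> group_algebra G"
proof -
  have "{g. f g + f' g \<noteq> 0} \<subseteq> {g. f g \<noteq> 0} \<union> {g. f' g \<noteq> 0}" by auto
  then show ?thesis using assms unfolding group_algebra_def
    by (auto intro: finite_subset)
qed

lemma extend_rep_scale:
  assumes "f \<in> group_algebra G"
  shows "(\<lambda>g. z * f g) \<in> group_algebra G"
    and "extend_rep U (\<lambda>g. z * f g) = cscalar z o\<^sub>L extend_rep U f"
proof -
  interpret c: bounded_bilinear "(o\<^sub>L) :: operator \<Rightarrow> operator \<Rightarrow> operator"
    by (rule bounded_bilinear_blinfun_compose)
  have sub: "{g. z * f g \<noteq> 0} \<subseteq> {g. f g \<noteq> 0}" by auto
  have fin: "finite {g. f g \<noteq> 0}" using assms by (auto simp: group_algebra_def)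
  show "(\<lambda>g. z * f g) \<in> group_algebra G"
    using assms sub by (auto simp: group_algebra_def intro: finite_subset)
  show "extend_rep U (\<lambda>g. z * f g) = cscalar z o\<^sub>L extend_rep U f"
    by (subst (1 2) extend_rep_superset[OF fin])
      (auto simp: c.sum_right cscalar_mult blinfun_compose_assoc)
qed

lemma norm_extend_rep_le:
  assumes f: "f \<in> group_algebra G" and U: "unitary_rep G U"
  shows "norm (extend_rep U f) \<le> (\<Sum>g | f g \<noteq> 0. cmod (f g))"
proof -
  have "norm (cscalar (f g) o\<^sub>L U g) \<le> cmod (f g)" if "f g \<noteq> 0" for g
  proof (rule norm_blinfun_bound)
    fix x
    have "g \<in> carrier G" using that f by (auto simp: group_algebra_def)
    then have "orthogonal_transformation (blinfun_apply (U g))"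
      using U by (simp add: unitary_rep_def orthogonal_rep_def)
    then have "norm (U g x) = norm x"
      by (simp add: norm_eq_sqrt_inner orthogonal_transformation_def)
    then show "norm ((cscalar (f g) o\<^sub>L U g) x) \<le> cmod (f g) * norm x"
      by (simp add: cscalar.rep_eq norm_cscale)
  qed simp
  then show ?thesis
    unfolding extend_rep_def by (intro order.trans[OF norm_sum] sum_mono) auto
qed

lemma cstar_max_carrier_iff:
  "a \<in> carrier (cstar_max G) \<longleftrightarrow> (\<forall>U. \<not> unitary_rep G U \<longrightarrow> a U = 0) \<and>
    (\<forall>e>0. \<exists>f\<in>group_algebra G. \<forall>U. unitary_rep G U \<longrightarrow> norm (a U - extend_rep U f) \<le> e)"
proof (intro iffI conjI allI impI)
  fix U
  assume a: "a \<in> carrier (cstar_max G)" and U: "\<not> unitary_rep G U"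
  have "norm (a U) \<le> e" if "e > 0" for e
  proof -
    have "\<exists>f\<in>group_algebra G. \<forall>U. norm (a U - universal_rep G f U) \<le> e"
      using a that by (simp add: cstar_max_def)
    then obtain f where "\<forall>U. norm (a U - universal_rep G f U) \<le> e" by blast
    from this[rule_format, of U] show ?thesis using U by (simp add: universal_rep_def)
  qed
  then have "norm (a U) \<le> 0" by (rule field_le_epsilon) simp
  then show "a U = 0" by simp
next
  fix e :: real
  assume "a \<in> carrier (cstar_max G)" "e > 0"
  then have "\<exists>f\<in>group_algebra G. \<forall>U. norm (a U - universal_rep G f U) \<le> e"
    by (simp add: cstar_max_def)
  then obtain f where "f \<in> group_algebra G" "\<And>U. norm (a U - universal_rep G f U) \<le> e"
    by blast
  moreover have "universal_rep G f U = extend_rep U f" if "unitary_rep G U" for U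
    using that by (simp add: universal_rep_def)
  ultimately show "\<exists>f\<in>group_algebra G. \<forall>U. unitary_rep G U \<longrightarrow> norm (a U - extend_rep U f) \<le> e"
    by metis
next
  assume *: "(\<forall>U. \<not> unitary_rep G U \<longrightarrow> a U = 0) \<and>
    (\<forall>e>0. \<exists>f\<in>group_algebra G. \<forall>U. unitary_rep G U \<longrightarrow> norm (a U - extend_rep U f) \<le> e)"
  have "\<exists>f\<in>group_algebra G. \<forall>U. norm (a U - universal_rep G f U) \<le> e" if e0: "e > 0" for e
  proof -
    obtain f where "f \<in> group_algebra G"
      "\<And>U. unitary_rep G U \<Longrightarrow> norm (a U - extend_rep U f) \<le> e"
      using * e0 by blast
    then have "norm (a U - universal_rep G f U) \<le> e" for U
      using * e0 by (cases "unitary_rep G U") (auto simp: universal_rep_def)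
    then show ?thesis using \<open>f \<in> group_algebra G\<close> by blast
  qed
  then show "a \<in> carrier (cstar_max G)" by (simp add: cstar_max_def)
qed

lemma cstar_max_approx:
  assumes "a \<in> carrier (cstar_max G)" "e > 0"
  obtains f where "f \<in> group_algebra G" "\<And>U. unitary_rep G U \<Longrightarrow> norm (a U - extend_rep U f) \<le> e"
  using assms by (auto simp: cstar_max_carrier_iff)

lemma universal_rep_in_cstar_max:
  "f \<in> group_algebra G \<Longrightarrow> universal_rep G f \<in> carrier (cstar_max G)"
  by (force simp: cstar_max_def)

lemma cstar_max_mult_closed:
  assumes G: "group G"
    and a: "a \<in> carrier (cstar_max G)" and b: "b \<in> carrier (cstar_max G)"
  shows "(\<lambda>U. a U o\<^sub>L b U) \<in> carrier (cstar_max G)"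
  unfolding cstar_max_carrier_iff
proof (intro conjI allI impI)
  interpret c: bounded_bilinear "(o\<^sub>L) :: operator \<Rightarrow> operator \<Rightarrow> operator"
    by (rule bounded_bilinear_blinfun_compose)
  show "a U o\<^sub>L b U = 0" if "\<not> unitary_rep G U" for U
    using a that by (simp add: cstar_max_carrier_iff)
  fix e :: real assume e: "e > 0"
  obtain h where h: "h \<in> group_algebra G" "\<And>U. unitary_rep G U \<Longrightarrow> norm (b U - extend_rep U h) \<le> 1"
    using b zero_less_one by (rule cstar_max_approx) blast
  define K where "K = 1 + (\<Sum>g | h g \<noteq> 0. cmod (h g))"
  have K: "K > 0" unfolding K_def by (smt (verit) norm_ge_zero sum_nonneg)
  have bK: "norm (b U) \<le> K" if "unitary_rep G U" for U
    using h(2)[OF that] norm_extend_rep_le[OF h(1) that] norm_triangle_sub[of "b U" "extend_rep U h"]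
    by (simp add: K_def)
  have eK: "e / (2 * K) > 0" using e K by simp
  obtain f where f: "f \<in> group_algebra G"
    "\<And>U. unitary_rep G U \<Longrightarrow> norm (a U - extend_rep U f) \<le> e / (2 * K)"
    by (rule cstar_max_approx[OF a eK]) blast
  define L where "L = 1 + (\<Sum>g | f g \<noteq> 0. cmod (f g))"
  have L: "L > 0" unfolding L_def by (smt (verit) norm_ge_zero sum_nonneg)
  have fL: "norm (extend_rep U f) \<le> L" if "unitary_rep G U" for U
    using norm_extend_rep_le[OF f(1) that] by (simp add: L_def)
  have eL: "e / (2 * L) > 0" using e L by simp
  obtain f' where f': "f' \<in> group_algebra G"
    "\<And>U. unitary_rep G U \<Longrightarrow> norm (b U - extend_rep U f') \<le> e / (2 * L)"
    by (rule cstar_max_approx[OF b eL]) blast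
  obtain k where k: "k \<in> group_algebra G"
    "\<And>U. unitary_rep G U \<Longrightarrow> extend_rep U k = extend_rep U f o\<^sub>L extend_rep U f'"
    using extend_rep_mult[OF G f(1) f'(1)] by blast
  have "norm ((a U o\<^sub>L b U) - extend_rep U k) \<le> e" if U: "unitary_rep G U" for U
  proof -
    have "(a U o\<^sub>L b U) - extend_rep U k
        = ((a U - extend_rep U f) o\<^sub>L b U) + (extend_rep U f o\<^sub>L (b U - extend_rep U f'))"
      by (simp add: k(2)[OF U] c.diff_left c.diff_right)
    also have "norm \<dots> \<le> norm ((a U - extend_rep U f) o\<^sub>L b U)
        + norm (extend_rep U f o\<^sub>L (b U - extend_rep U f'))"
      by (rule norm_triangle_ineq)
    also have "\<dots> \<le> norm (a U - extend_rep U f) * norm (b U)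
        + norm (extend_rep U f) * norm (b U - extend_rep U f')"
      by (intro add_mono norm_blinfun_compose)
    also have "\<dots> \<le> e / (2 * K) * K + L * (e / (2 * L))"
      using f(2)[OF U] f'(2)[OF U] bK[OF U] fL[OF U] e K L
      by (intro add_mono mult_mono) auto
    also have "\<dots> = e" using K L by simp
    finally show ?thesis .
  qed
  then show "\<exists>f\<in>group_algebra G. \<forall>U. unitary_rep G U \<longrightarrow> norm ((a U o\<^sub>L b U) - extend_rep U f) \<le> e"
    using k(1) by blast
qed

lemma cstar_max_add_closed:
  assumes a: "a \<in> carrier (cstar_max G)" and b: "b \<in> carrier (cstar_max G)"
  shows "(\<lambda>U. a U + b U) \<in> carrier (cstar_max G)"
  unfolding cstar_max_carrier_iff
proof (intro conjI allI impI)
  show "a U + b U = 0" if "\<not> unitary_rep G U" for U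
    using a b that by (simp add: cstar_max_carrier_iff)
  fix e :: real assume e: "e > 0"
  obtain f where f: "f \<in> group_algebra G"
    "\<And>U. unitary_rep G U \<Longrightarrow> norm (a U - extend_rep U f) \<le> e / 2"
    using a half_gt_zero[OF e] by (rule cstar_max_approx) blast
  obtain f' where f': "f' \<in> group_algebra G"
    "\<And>U. unitary_rep G U \<Longrightarrow> norm (b U - extend_rep U f') \<le> e / 2"
    using b half_gt_zero[OF e] by (rule cstar_max_approx) blast
  have "norm (a U + b U - extend_rep U (\<lambda>g. f g + f' g)) \<le> e" if "unitary_rep G U" for U
    using norm_diff_triangle_ineq[of "a U" "b U" "extend_rep U f" "extend_rep U f'"]
      f(2)[OF that] f'(2)[OF that]
    by (simp add: extend_rep_add[OF f(1) f'(1)])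
  then show "\<exists>f\<in>group_algebra G. \<forall>U. unitary_rep G U \<longrightarrow> norm (a U + b U - extend_rep U f) \<le> e"
    using group_algebra_add[OF f(1) f'(1)] by blast
qed

lemma cstar_max_smult_closed:
  assumes a: "a \<in> carrier (cstar_max G)"
  shows "(\<lambda>U. cscalar z o\<^sub>L a U) \<in> carrier (cstar_max G)"
  unfolding cstar_max_carrier_iff
proof (intro conjI allI impI)
  interpret c: bounded_bilinear "(o\<^sub>L) :: operator \<Rightarrow> operator \<Rightarrow> operator"
    by (rule bounded_bilinear_blinfun_compose)
  show "cscalar z o\<^sub>L a U = 0" if "\<not> unitary_rep G U" for U
    using a that by (simp add: cstar_max_carrier_iff)
  fix e :: real assume e: "e > 0"
  define K where "K = norm (cscalar z) + 1"
  have K: "K > 0" unfolding K_def by (smt (verit) norm_ge_zero)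
  obtain f where f: "f \<in> group_algebra G"
    "\<And>U. unitary_rep G U \<Longrightarrow> norm (a U - extend_rep U f) \<le> e / K"
    using a divide_pos_pos[OF e K] by (rule cstar_max_approx) blast
  have "norm ((cscalar z o\<^sub>L a U) - extend_rep U (\<lambda>g. z * f g)) \<le> e" if "unitary_rep G U" for U
  proof -
    have "(cscalar z o\<^sub>L a U) - extend_rep U (\<lambda>g. z * f g) = cscalar z o\<^sub>L (a U - extend_rep U f)"
      by (simp add: extend_rep_scale(2)[OF f(1)] c.diff_right)
    also have "norm \<dots> \<le> norm (cscalar z) * norm (a U - extend_rep U f)"
      by (rule norm_blinfun_compose)
    also have "\<dots> \<le> K * (e / K)"
      using f(2)[OF that] K by (intro mult_mono) (auto simp: K_def)
    finally show ?thesis using K by simp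
  qed
  then show "\<exists>f\<in>group_algebra G. \<forall>U. unitary_rep G U \<longrightarrow> norm ((cscalar z o\<^sub>L a U) - extend_rep U f) \<le> e"
    using extend_rep_scale(1)[OF f(1)] by blast
qed

lemma cstar_max_one_closed:
  assumes "group G"
  shows "\<one>\<^bsub>cstar_max G\<^esub> \<in> carrier (cstar_max G)"
proof -
  interpret group G by fact
  let ?f = "\<lambda>g. if g = \<one>\<^bsub>G\<^esub> then 1 else 0 :: complex"
  have "?f \<in> group_algebra G" by (auto simp: group_algebra_def)
  moreover have "\<one>\<^bsub>cstar_max G\<^esub> = universal_rep G ?f"
    by (auto simp: cstar_max_def universal_rep_def extend_rep_def fun_eq_iff cscalar_one
      unitary_rep_def orthogonal_rep_def intro!: blinfun_eqI)
  ultimately show ?thesis by (simp add: universal_rep_in_cstar_max)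
qed

lemma ring_cstar_max:
  assumes "group G"
  shows "ring (cstar_max G)"
proof -
  interpret c: bounded_bilinear "(o\<^sub>L) :: operator \<Rightarrow> operator \<Rightarrow> operator"
    by (rule bounded_bilinear_blinfun_compose)
  have ops: "x \<oplus>\<^bsub>cstar_max G\<^esub> y = (\<lambda>U. x U + y U)" "x \<otimes>\<^bsub>cstar_max G\<^esub> y = (\<lambda>U. x U o\<^sub>L y U)"
    "\<zero>\<^bsub>cstar_max G\<^esub> = (\<lambda>U. 0)" for x y
    by (simp_all add: cstar_max_def)
  have zero: "(\<lambda>U. 0) \<in> carrier (cstar_max G)"
    using cstar_max_smult_closed[OF cstar_max_one_closed[OF assms], of 0]
    by (simp add: cscalar_zero)
  have 1: "abelian_group (cstar_max G)"
  proof (rule abelian_groupI, goal_cases)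
    case (6 x)
    have "(\<lambda>U. cscalar (-1) o\<^sub>L x U) \<in> carrier (cstar_max G)"
      by (rule cstar_max_smult_closed[OF 6])
    moreover have "(cscalar (-1) o\<^sub>L x U) + x U = 0" for U
      by (metis add.left_inverse blinfun_compose_zero(1) c.add_left cscalar_add cscalar_one
        cscalar_zero id_blinfun_compose)
    ultimately show ?case by (intro bexI[of _ "\<lambda>U. cscalar (-1) o\<^sub>L x U"]) (simp_all add: ops)
  qed (auto simp: ops zero cstar_max_add_closed algebra_simps)
  have 2: "monoid (cstar_max G)"
  proof (rule monoidI, goal_cases)
    case (4 x)
    then have "x U = 0" if "\<not> unitary_rep G U" for U
      using that by (simp add: cstar_max_carrier_iff)
    then show ?case
      by (auto simp: cstar_max_def fun_eq_iff id_blinfun_compose)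
  next
    case (5 x)
    then have "x U = 0" if "\<not> unitary_rep G U" for U
      using that by (simp add: cstar_max_carrier_iff)
    then show ?case
      by (auto simp: cstar_max_def fun_eq_iff compose_id_blinfun)
  qed (auto simp: ops cstar_max_mult_closed assms cstar_max_one_closed blinfun_compose_assoc)
  show ?thesis
    by (rule ringI[OF 1 2]) (simp_all add: ops c.add_left c.add_right)
qed


section \<open>The Laplacian and its spectral gap\<close>

definition spectrum :: "(complex, 'a) module \<Rightarrow> 'a \<Rightarrow> complex set" where
  "spectrum A a = {z. (z \<odot>\<^bsub>A\<^esub> \<one>\<^bsub>A\<^esub>) \<ominus>\<^bsub>A\<^esub> a \<notin> Units A}"


definition group_elem :: "'g \<Rightarrow> 'g \<Rightarrow> real" where
  "group_elem g = (\<lambda>h. if h = g then 1 else 0)"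

definition laplacian :: "('g, 'm) monoid_scheme \<Rightarrow> 'g set \<Rightarrow> 'g \<Rightarrow> real" where
  "laplacian G S = (\<lambda>h. real (card S) * group_elem \<one>\<^bsub>G\<^esub> h - (\<Sum>s\<in>S. group_elem s h))"

definition laplacian_max ::
  "('g, 'm) monoid_scheme \<Rightarrow> 'g set \<Rightarrow> ('g \<Rightarrow> operator) \<Rightarrow> operator" where
  "laplacian_max G S = universal_rep G (\<lambda>h. complex_of_real (laplacian G S h))"

lemma laplacian_max_closed:
  assumes "group G" "finite S" "S \<subseteq> carrier G"
  shows "laplacian_max G S \<in> carrier (cstar_max G)"
proof -
  interpret group G by fact
  have "laplacian G S h = 0" if "h \<notin> insert \<one>\<^bsub>G\<^esub> S" for h
  proof -
    have "(\<Sum>s\<in>S. group_elem s h) = 0"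
      using that by (intro sum.neutral) (auto simp: group_elem_def)
    then show ?thesis using that by (simp add: laplacian_def group_elem_def)
  qed
  then have "{h. complex_of_real (laplacian G S h) \<noteq> 0} \<subseteq> insert \<one>\<^bsub>G\<^esub> S" by auto
  then have "(\<lambda>h. complex_of_real (laplacian G S h)) \<in> group_algebra G"
    using assms by (auto simp: group_algebra_def dest: finite_subset)
  then show ?thesis
    unfolding laplacian_max_def by (rule universal_rep_in_cstar_max)
qed

text \<open>Extended-real valued: for the trivial group the spectrum is \<open>{0}\<close> and the gap is infinite.\<close>

definition spectral_gap :: "('g, 'm) monoid_scheme \<Rightarrow> 'g set \<Rightarrow> ereal" where
  "spectral_gap G S = Sup {ereal e | e. 0 \<le> e \<and>
     (\<forall>x\<in>{0<..<e}. complex_of_real x \<notin> spectrum (cstar_max G) (laplacian_max G S))}"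

end

theory Submission
  imports Defs "HOL-Complex_Analysis.Great_Picard"
begin

text \<open>For an orthogonal representation \<open>\<pi>\<close> and a vector \<open>\<xi>\<close>, the coboundary \<open>b g = \<pi> g \<xi> - \<xi>\<close>
  satisfies \<open>\<Sum>s. (norm (b s))\<^sup>2 = 2 * inner (\<Delta> \<xi>) \<xi>\<close> and \<open>norm (\<Sum>s. b s) = norm (\<Delta> \<xi>)\<close>, where \<open>\<Delta>\<close> acts
  through \<open>\<pi>\<close>.  So the operator inequality \<open>\<Delta>\<^sup>2 \<ge> \<eta> \<Delta>\<close>, which for a self-adjoint operator
  says that the spectrum misses \<open>{0<..<\<eta>}\<close>, is a statement about coboundaries:
  \<open>\<eta> * (\<Sum>s. (norm (b s))\<^sup>2) \<le> 2 * (norm (\<Sum>s. b s))\<^sup>2\<close>.  That this inequality for all unitary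
  representations is equivalent to a gap in the maximal group C*-algebra is
  \<open>spectrum_avoids_iff\<close>.  One direction is spectral theory in a single representation
  (\<open>spectral_inequality_of_left_inverses\<close>).  In the other direction the inequality bounds \<open>\<Delta> - t\<close>
  from below, uniformly over all representations, and a Neumann series with uniform error
  produces an inverse inside the C*-algebra (\<open>cstar_max_unit_if_bounded_below\<close>).

  It remains to compare cocycles with coboundaries, which involves two limits.

  The inequality passes from coboundaries to every cocycle \<open>c\<close> (\<open>cocycle_inequality\<close>).  By
  Schoenberg, the kernel \<open>exp (- t * (norm (c g - c h))\<^sup>2)\<close> is positive semidefinite; it is
  invariant under translations, so it comes from a representation with a distinguished
  vector.  The Gram matrix of the corresponding coboundary, divided by \<open>t\<close>, tends to twice the Gram
  matrix of \<open>c\<close> as \<open>t\<close> tends to \<open>0\<close>.  Hence the gap is a lower bound for the values in question.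

  Conversely, each \<open>\<eta>\<close> above the gap is beaten by a normalised coboundary
  (\<open>normalized_cocycle_below\<close>).  Normalised cocycles are bounded at each group element by a
  constant depending only on that element, so along a subsequence
  their Gram matrices converge, and a limit of Gram matrices of cocycles is
  again the Gram matrix of a cocycle (\<open>limit_cocycle\<close>).  This cocycle attains the gap.

  Both limits need a representation recovered from an invariant kernel on a countable set, and
  the Hilbert space has to be the concrete space of square-summable sequences.  There, Gaussian
  elimination replaces the abstract completion: the Cholesky factor of a kernel gives finitely
  supported vectors with that Gram matrix (\<open>gram_realization\<close>), and \<open>gns_construction\<close> turns a
  group action on the index set into an orthogonal representation.\<close>

section \<open>Positive semidefinite kernels\<close>

text \<open>The points \<open>x i\<close> may repeat and are indexed by numbers, so that kernels can be pulled back along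
  arbitrary, possibly non-injective, maps.\<close>

definition psd :: "('i \<Rightarrow> 'i \<Rightarrow> real) \<Rightarrow> bool" where
  "psd K \<longleftrightarrow> (\<forall>x y. K x y = K y x) \<and>
     (\<forall>(n::nat) a x. 0 \<le> (\<Sum>i<n. \<Sum>j<n. a i * a j * K (x i) (x j)))"

lemma psd_commute: "psd K \<Longrightarrow> K x y = K y x"
  by (simp add: psd_def)

lemma psd_nonneg:
  fixes n :: nat and a x
  assumes "psd K"
  shows "0 \<le> (\<Sum>i<n. \<Sum>j<n. a i * a j * K (x i) (x j))"
  using assms by (simp add: psd_def)

lemma psd_comp:
  assumes "psd K"
  shows "psd (\<lambda>x y. K (f x) (f y))"
  using psd_commute[OF assms] psd_nonneg[OF assms, of _ "\<lambda>i. f (_ i)"] by (simp add: psd_def)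

lemma quadratic_form_gram:
  fixes v :: "nat \<Rightarrow> 'a::real_inner"
  shows "(\<Sum>i<n. \<Sum>j<n. a i * a j * inner (v i) (v j)) = (norm (\<Sum>i<n. a i *\<^sub>R v i))\<^sup>2"
  unfolding power2_norm_eq_inner inner_sum_left inner_sum_right
  by (subst sum.swap) (simp add: inner_commute mult_ac)

lemma psd_gram: "psd (\<lambda>x y. inner (v x) (v y))"
  by (simp add: psd_def inner_commute quadratic_form_gram)

lemma psd_diag_nonneg: "psd K \<Longrightarrow> 0 \<le> K x x"
  using psd_nonneg[of K "\<lambda>_. 1" "\<lambda>_. x" 1] by simp

lemma psd_add: "psd K \<Longrightarrow> psd L \<Longrightarrow> psd (\<lambda>x y. K x y + L x y)"
  by (simp add: psd_def distrib_left sum.distrib)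

lemma psd_scale:
  assumes "psd K" "0 \<le> c"
  shows "psd (\<lambda>x y. c * K x y)"
proof -
  have "(\<Sum>i<n. \<Sum>j<n. a i * a j * (c * K (x i) (x j))) = c * (\<Sum>i<n. \<Sum>j<n. a i * a j * K (x i) (x j))"
    for n :: nat and a x
    by (simp add: sum_distrib_left mult_ac)
  then show ?thesis
    using assms by (simp add: psd_def)
qed

lemma psd_rescale:
  assumes "psd K"
  shows "psd (\<lambda>x y. f x * f y * K x y)"
proof -
  have "0 \<le> (\<Sum>i<n. \<Sum>j<n. a i * a j * (f (x i) * f (x j) * K (x i) (x j)))"
    for n :: nat and a x
    using psd_nonneg[OF assms, of "\<lambda>i. a i * f (x i)" x n] by (simp add: mult_ac)
  then show ?thesis
    unfolding psd_def using psd_commute[OF assms] by (simp add: mult.commute)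
qed

lemma psd_limit:
  assumes "\<And>n. psd (K n)" and lim: "\<And>x y. (\<lambda>n. K n x y) \<longlonglongrightarrow> L x y"
  shows "psd L"
proof -
  have "L x y = L y x" for x y
    using LIMSEQ_unique[OF lim[of x y]] lim[of y x] psd_commute[OF assms(1)] by simp
  moreover have "0 \<le> (\<Sum>i<n. \<Sum>j<n. a i * a j * L (x i) (x j))" for n :: nat and a x
  proof (rule LIMSEQ_le_const)
    show "(\<lambda>m. \<Sum>i<n. \<Sum>j<n. a i * a j * K m (x i) (x j))
        \<longlonglongrightarrow> (\<Sum>i<n. \<Sum>j<n. a i * a j * L (x i) (x j))"
      by (intro tendsto_intros lim)
  qed (auto intro: psd_nonneg[OF assms(1)])
  ultimately show ?thesis by (simp add: psd_def)
qed

text \<open>A semidefinite quadratic form cannot have a linear term in a direction in which its quadratic term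
  vanishes.  Elimination therefore never divides a nonzero number by a zero pivot.\<close>

lemma psd_cross_zero:
  assumes K: "psd K" and zero: "K y y = 0"
  shows "K x y = 0"
proof (rule ccontr)
  assume nz: "K x y \<noteq> 0"
  have "0 \<le> K x x + 2 * t * K x y" for t
  proof -
    let ?a = "(\<lambda>_. t)(0 := 1)" and ?x = "(\<lambda>_. y)(0 := x)"
    have "(\<Sum>i<(2::nat). \<Sum>j<(2::nat). ?a i * ?a j * K (?x i) (?x j)) = K x x + 2 * t * K x y"
      using zero psd_commute[OF K, of y x] by (simp add: numeral_2_eq_2)
    then show ?thesis
      using psd_nonneg[OF K, of ?a ?x 2] by simp
  qed
  \<comment> \<open>The value of \<open>t\<close> at which the affine function of \<open>t\<close> equals \<open>-1\<close>.\<close>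
  from this[of "- (K x x + 1) / (2 * K x y)"]
  have "0 \<le> K x x + 2 * (- (K x x + 1) / (2 * K x y)) * K x y" .
  also have "2 * (- (K x x + 1) / (2 * K x y)) * K x y = - (K x x + 1)" using nz by simp
  finally show False by simp
qed

text \<open>Elimination of the point \<open>m\<close>.  If the pivot \<open>K m m\<close> is zero, division by zero leaves \<open>K\<close>
  unchanged, which is the correct step because row and column \<open>m\<close> are then zero already.\<close>

definition schur_complement :: "('i \<Rightarrow> 'i \<Rightarrow> real) \<Rightarrow> 'i \<Rightarrow> 'i \<Rightarrow> 'i \<Rightarrow> real" where
  "schur_complement K m = (\<lambda>x y. K x y - K x m * K m y / K m m)"

text \<open>The quadratic form of the Schur complement at \<open>a\<close> is the minimum over \<open>t\<close> of the form of \<open>K\<close> at \<open>a\<close>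
  extended by the coefficient \<open>t\<close> at the point \<open>m\<close>.\<close>

lemma psd_schur_complement:
  assumes K: "psd K"
  shows "psd (schur_complement K m)"
proof -
  have "0 \<le> (\<Sum>i<n. \<Sum>j<n. a i * a j * (K (x i) (x j) - K (x i) m * K m (x j) / K m m))"
    for n :: nat and a x
  proof -
    have comm: "K m (x i) = K (x i) m" for i by (rule psd_commute[OF K])
    define B where "B = (\<Sum>i<n. a i * K (x i) m)"
    define Q where "Q = (\<Sum>i<n. \<Sum>j<n. a i * a j * K (x i) (x j))"
    define t where "t = - B / K m m"
    let ?a = "a(n := t)" and ?x = "x(n := m)"
    have "B * B / K m m = (\<Sum>i<n. \<Sum>j<n. a i * a j * (K (x i) m * K m (x j) / K m m))"
      by (simp add: B_def sum_product sum_divide_distrib comm mult_ac)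
    then have 1: "(\<Sum>i<n. \<Sum>j<n. a i * a j * (K (x i) (x j) - K (x i) m * K m (x j) / K m m))
        = Q - B * B / K m m"
      by (simp add: Q_def right_diff_distrib sum_subtractf)
    have B': "(\<Sum>i<n. a i * K m (x i)) = B"
      by (simp add: B_def comm)
    have "(\<Sum>i<Suc n. \<Sum>j<Suc n. ?a i * ?a j * K (?x i) (?x j))
        = Q + (\<Sum>i<n. t * (a i * K (x i) m)) + ((\<Sum>i<n. t * (a i * K m (x i))) + t * t * K m m)"
      by (simp add: Q_def sum.distrib mult_ac)
    also have "\<dots> = Q + 2 * t * B + t * t * K m m"
      unfolding sum_distrib_left[symmetric] B' B_def[symmetric] by simp
    also have "\<dots> = Q - B * B / K m m"
      by (simp add: t_def field_simps)
    finally show ?thesis using psd_nonneg[OF K, of ?a ?x "Suc n"] 1 by simp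
  qed
  then show ?thesis
    unfolding psd_def schur_complement_def using psd_commute[OF K] by (simp add: mult.commute)
qed

primrec schur_iterate :: "(nat \<Rightarrow> nat \<Rightarrow> real) \<Rightarrow> nat \<Rightarrow> nat \<Rightarrow> nat \<Rightarrow> real" where
  "schur_iterate K 0 = K"
| "schur_iterate K (Suc n) = schur_complement (schur_iterate K n) n"

lemma psd_schur_iterate: "psd K \<Longrightarrow> psd (schur_iterate K n)"
  by (induction n) (auto intro: psd_schur_complement)

lemma schur_iterate_eq_0:
  assumes K: "psd K"
  shows "i < n \<Longrightarrow> schur_iterate K n i j = 0"
proof (induction n arbitrary: j)
  case (Suc n)
  let ?L = "schur_iterate K n"
  have L: "psd ?L" by (rule psd_schur_iterate[OF K])
  show ?case
  proof (cases "i = n")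
    case True
    have "?L n j = 0" if "?L n n = 0"
      using psd_cross_zero[OF L that, of j] psd_commute[OF L, of n j] by simp
    then show ?thesis
      unfolding True by (cases "?L n n = 0") (simp_all add: schur_complement_def)
  next
    case False
    with Suc.prems have "i < n" by simp
    then have "?L i j = 0" "?L i n = 0" by (rule Suc.IH)+
    then show ?thesis by (simp add: schur_complement_def)
  qed
qed simp

text \<open>The lower triangular factor produced by eliminating the points \<open>0, 1, 2, \<dots>\<close> in turn.  A vanishing
  pivot yields a zero column.\<close>

definition cholesky :: "(nat \<Rightarrow> nat \<Rightarrow> real) \<Rightarrow> nat \<Rightarrow> nat \<Rightarrow> real" where
  "cholesky K i k = schur_iterate K k i k / sqrt (schur_iterate K k k k)"

lemma cholesky_upper: "psd K \<Longrightarrow> i < k \<Longrightarrow> cholesky K i k = 0"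
  by (simp add: cholesky_def schur_iterate_eq_0)

lemma cholesky_diag_zero:
  assumes "psd K" "cholesky K k k = 0"
  shows "cholesky K i k = 0"
proof -
  have "schur_iterate K k k k = 0"
    using assms(2) by (simp add: cholesky_def real_div_sqrt psd_diag_nonneg[OF psd_schur_iterate[OF assms(1)]])
  then show ?thesis by (simp add: cholesky_def)
qed

lemma cholesky_partial:
  assumes K: "psd K"
  shows "K i j = (\<Sum>k<n. cholesky K i k * cholesky K j k) + schur_iterate K n i j"
proof (induction n)
  case (Suc n)
  let ?L = "schur_iterate K n"
  have L: "psd ?L" by (rule psd_schur_iterate[OF K])
  have "cholesky K i n * cholesky K j n = ?L i n * ?L n j / ?L n n"
    using psd_diag_nonneg[OF L, of n] psd_commute[OF L, of n j] by (simp add: cholesky_def)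
  with Suc show ?case by (simp add: schur_complement_def)
qed simp

lemma cholesky_decomposition:
  assumes "psd K" "i < n"
  shows "K i j = (\<Sum>k<n. cholesky K i k * cholesky K j k)"
  using cholesky_partial[OF assms(1), of i j n] schur_iterate_eq_0[OF assms] by simp

text \<open>The Schur product theorem: inserting the Cholesky factorisation of one factor exhibits the form of the
  product as a sum of forms of the other factor.\<close>

lemma psd_mult:
  assumes K: "psd K" and L: "psd L"
  shows "psd (\<lambda>x y. K x y * L x y)"
proof -
  have "0 \<le> (\<Sum>i<n. \<Sum>j<n. a i * a j * (K (x i) (x j) * L (x i) (x j)))" for n :: nat and a x
  proof -
    define c where "c = cholesky (\<lambda>i j. K (x i) (x j))"
    have "(\<Sum>i<n. \<Sum>j<n. a i * a j * (K (x i) (x j) * L (x i) (x j)))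
        = (\<Sum>i<n. \<Sum>j<n. \<Sum>k<n. (a i * c i k) * (a j * c j k) * L (x i) (x j))"
    proof (intro sum.cong refl)
      fix i j assume "i \<in> {..<n}"
      then have "K (x i) (x j) = (\<Sum>k<n. c i k * c j k)"
        using cholesky_decomposition[OF psd_comp[OF K, of x], of i n j] by (simp add: c_def)
      then show "a i * a j * (K (x i) (x j) * L (x i) (x j))
        = (\<Sum>k<n. (a i * c i k) * (a j * c j k) * L (x i) (x j))"
        by (simp add: sum_distrib_left sum_distrib_right mult_ac)
    qed
    also have "\<dots> = (\<Sum>i<n. \<Sum>k<n. \<Sum>j<n. (a i * c i k) * (a j * c j k) * L (x i) (x j))"
      by (intro sum.cong refl sum.swap)
    also have "\<dots> = (\<Sum>k<n. \<Sum>i<n. \<Sum>j<n. (a i * c i k) * (a j * c j k) * L (x i) (x j))"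
      by (rule sum.swap)
    also have "\<dots> \<ge> 0"
      by (intro sum_nonneg psd_nonneg[OF L])
    finally show ?thesis .
  qed
  then show ?thesis
    using psd_commute[OF K] psd_commute[OF L] by (simp add: psd_def)
qed

lemma psd_exp:
  assumes K: "psd K"
  shows "psd (\<lambda>x y. exp (K x y))"
proof -
  have one: "psd (\<lambda>x y. 1)" using psd_gram[of "\<lambda>_. 1::real"] by simp
  have pow: "psd (\<lambda>x y. K x y ^ n)" for n
    by (induction n) (auto intro: one psd_mult[OF K])
  have "psd (\<lambda>x y. \<Sum>k<n. K x y ^ k / fact k)" for n
  proof (induction n)
    case 0 then show ?case by (simp add: psd_def)
  next
    case (Suc n)
    have "psd (\<lambda>x y. K x y ^ n / fact n)"
      using psd_scale[OF pow[of n], of "1 / fact n"] by simp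
    with Suc show ?case by (auto intro: psd_add)
  qed
  then show ?thesis
  proof (rule psd_limit)
    fix x y
    show "(\<lambda>n. \<Sum>k<n. K x y ^ k / fact k) \<longlonglongrightarrow> exp (K x y)"
      using exp_converges[of "K x y"] by (simp add: sums_def divide_inverse mult.commute)
  qed
qed

text \<open>Schoenberg's theorem for the squared distance: up to a rescaling by functions of one variable the
  kernel is the exponential of a Gram matrix.\<close>

lemma psd_gaussian:
  fixes v :: "'i \<Rightarrow> 'a::real_inner"
  assumes "0 \<le> t"
  shows "psd (\<lambda>x y. exp (- t * (norm (v x - v y))\<^sup>2))"
proof -
  have "psd (\<lambda>x y. exp (- t * (norm (v x))\<^sup>2) * exp (- t * (norm (v y))\<^sup>2)
      * exp ((2 * t) * inner (v x) (v y)))"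
    using assms by (intro psd_rescale psd_exp psd_scale psd_gram) auto
  moreover have "exp (- t * (norm (v x))\<^sup>2) * exp (- t * (norm (v y))\<^sup>2)
      * exp ((2 * t) * inner (v x) (v y)) = exp (- t * (norm (v x - v y))\<^sup>2)" for x y
    unfolding exp_add[symmetric] power2_norm_eq_inner
    by (simp add: inner_diff_left inner_diff_right inner_commute algebra_simps)
  ultimately show ?thesis by simp
qed

section \<open>Realising kernels in the space of square-summable sequences\<close>

instance ell2 :: ("{real_inner, complete_space}") banach ..

lemma seq_diff: "seq (x - y) n = seq x n - seq y n"
  by transfer simp

lemma seq_scaleR: "seq (r *\<^sub>R x) n = r *\<^sub>R seq x n"
  by transfer simp

lemma seq_sum: "seq (sum f A) n = (\<Sum>i\<in>A. seq (f i) n)"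
  by (induction A rule: infinite_finite_induct) (simp_all add: zero_ell2.rep_eq plus_ell2.rep_eq)

lift_definition unit_vector :: "nat \<Rightarrow> real ell2" is "\<lambda>k n. if n = k then 1 else 0"
  by (rule summable_finite[of "{_}"]) auto

lemma inner_unit_vector: "inner (unit_vector j) (unit_vector k) = (if j = k then 1 else 0)"
proof -
  have "inner (unit_vector j) (unit_vector k)
      = (\<Sum>n. (if n = j then 1 else 0) * (if n = k then 1 else 0 :: real))"
    by (simp add: inner_ell2.rep_eq unit_vector.rep_eq)
  also have "\<dots> = (\<Sum>n\<in>{j}. (if n = j then 1 else 0) * (if n = k then 1 else 0 :: real))"
    by (rule suminf_finite) auto
  finally show ?thesis by simp
qed

lemma closure_span_unit_vectors: "closure (span (range unit_vector)) = UNIV"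
proof -
  have "x \<in> closure (span (range unit_vector))" for x
  proof -
    define X where "X n = (\<Sum>k<n. seq x k *\<^sub>R unit_vector k)" for n
    have seq_X: "seq (X n) m = (if m < n then seq x m else 0)" for n m
      by (simp add: X_def seq_sum seq_scaleR unit_vector.rep_eq if_distrib cong: if_cong)
    have "(norm (X n - x))\<^sup>2 = (\<Sum>m. (norm (seq x m))\<^sup>2) - (\<Sum>m<n. (norm (seq x m))\<^sup>2)" for n
    proof -
      have "(norm (X n - x))\<^sup>2 = (\<Sum>m. (norm (seq x m))\<^sup>2 - (if m < n then (norm (seq x m))\<^sup>2 else 0))"
        unfolding norm_ell2_square by (rule arg_cong[of _ _ suminf]) (auto simp: seq_diff seq_X)
      also have "\<dots> = (\<Sum>m. (norm (seq x m))\<^sup>2) - (\<Sum>m. if m < n then (norm (seq x m))\<^sup>2 else 0)"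
        by (intro suminf_diff[symmetric] summable_seq summable_finite[of "{..<n}"]) auto
      also have "(\<Sum>m. if m < n then (norm (seq x m))\<^sup>2 else 0) = (\<Sum>m<n. (norm (seq x m))\<^sup>2)"
        by (subst suminf_finite[of "{..<n}"]) auto
      finally show ?thesis .
    qed
    moreover have "(\<lambda>n. (\<Sum>m. (norm (seq x m))\<^sup>2) - (\<Sum>m<n. (norm (seq x m))\<^sup>2)) \<longlonglongrightarrow> 0"
      using tendsto_diff[OF tendsto_const summable_LIMSEQ[OF summable_seq[of x]],
          of "\<Sum>m. (norm (seq x m))\<^sup>2"] by simp
    ultimately have "(\<lambda>n. (norm (X n - x))\<^sup>2) \<longlonglongrightarrow> 0" by simp
    then have "(\<lambda>n. sqrt ((norm (X n - x))\<^sup>2)) \<longlonglongrightarrow> sqrt 0" by (rule tendsto_real_sqrt)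
    then have "(\<lambda>n. norm (X n - x)) \<longlonglongrightarrow> 0" by simp
    then have "X \<longlonglongrightarrow> x" by (rule LIM_zero_cancel[OF tendsto_norm_zero_cancel])
    moreover have "X n \<in> span (range unit_vector)" for n
      unfolding X_def by (intro span_sum span_scale span_base) auto
    ultimately show ?thesis unfolding closure_sequential by (intro exI[of _ X]) simp
  qed
  then show ?thesis by blast
qed

text \<open>The rows of the Cholesky factor have the prescribed inner products.  The closed span of these rows is
  the coordinate subspace of the nonzero pivots, because each such unit vector is obtained by
  back substitution.  The remaining unit vectors \<open>u\<close> complete the family to a total one; a
  representation can then act trivially on them.\<close>

theorem gram_realization:
  assumes K: "psd K"
  obtains w u :: "nat \<Rightarrow> real ell2"
  where "\<And>i j. inner (w i) (w j) = K i j" "\<And>i j. inner (w i) (u j) = 0"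
    "closure (span (range w \<union> range u)) = UNIV"
proof -
  define w where "w i = (\<Sum>k\<le>i. cholesky K i k *\<^sub>R unit_vector k)" for i
  define u where "u k = (if cholesky K k k = 0 then unit_vector k else 0)" for k
  have w_eq: "w i = (\<Sum>k<n. cholesky K i k *\<^sub>R unit_vector k)" if "i < n" for i n
    unfolding w_def using that
    by (intro sum.mono_neutral_left) (auto simp: cholesky_upper[OF K] not_le)
  have "\<And>i j. inner (w i) (w j) = K i j"
  proof -
    fix i j
    define n where "n = Suc (max i j)"
    have "inner (w i) (w j) = inner (\<Sum>k<n. cholesky K i k *\<^sub>R unit_vector k)
        (\<Sum>k<n. cholesky K j k *\<^sub>R unit_vector k)"
      using w_eq[of i n] w_eq[of j n] by (simp add: n_def)
    also have "\<dots> = (\<Sum>k<n. cholesky K i k * cholesky K j k)"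
      by (simp add: inner_sum_left inner_sum_right inner_unit_vector if_distrib mult.commute cong: if_cong)
    also have "\<dots> = K i j"
      by (rule cholesky_decomposition[OF K, symmetric]) (simp add: n_def)
    finally show "inner (w i) (w j) = K i j" .
  qed
  moreover have "\<And>i j. inner (w i) (u j) = 0"
  proof -
    fix i j
    show "inner (w i) (u j) = 0"
    proof (cases "cholesky K j j = 0")
      case True
      have "cholesky K i j = 0" by (rule cholesky_diag_zero[OF K True])
      then show ?thesis
        by (simp add: True w_def u_def inner_sum_left inner_unit_vector if_distrib cong: if_cong)
    qed (simp add: u_def)
  qed
  moreover have "closure (span (range w \<union> range u)) = UNIV"
  proof -
    have e: "unit_vector k \<in> span (range w \<union> range u)" for k
    proof (induction k rule: less_induct)
      case (less k)
      show ?case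
      proof (cases "cholesky K k k = 0")
        case True
        then have "unit_vector k = u k" by (simp add: u_def)
        then show ?thesis by (simp add: span_base)
      next
        case False
        have "w k = (\<Sum>j<k. cholesky K k j *\<^sub>R unit_vector j) + cholesky K k k *\<^sub>R unit_vector k"
          using w_eq[of k "Suc k"] by simp
        then have "unit_vector k
            = (1 / cholesky K k k) *\<^sub>R (w k - (\<Sum>j<k. cholesky K k j *\<^sub>R unit_vector j))"
          using False by simp
        also have "\<dots> \<in> span (range w \<union> range u)"
          using less by (intro span_scale span_diff span_sum) (auto intro: span_base)
        finally show ?thesis .
      qed
    qed
    have "span (range unit_vector) \<subseteq> span (range w \<union> range u)"
      using e by (intro span_minimal) auto
    from closure_mono[OF this] show ?thesis
      unfolding closure_span_unit_vectors by blast
  qed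
  ultimately show ?thesis by (rule that[of w u])
qed

section \<open>Orthogonal representations from group actions on families of vectors\<close>

lemma eq_if_inner_eq_on_total:
  fixes x y :: "'h::real_inner"
  assumes total: "closure (span V) = UNIV" and eq: "\<And>v. v \<in> V \<Longrightarrow> inner x v = inner y v"
  shows "x = y"
proof -
  define z where "z = x - y"
  have "subspace {v. inner z v = 0}" by (simp add: subspace_def inner_simps)
  then have "span V \<subseteq> {v. inner z v = 0}"
    using eq by (intro span_minimal) (auto simp: z_def inner_diff_left)
  moreover have "closed {v. inner z v = 0}"
    by (intro closed_Collect_eq continuous_intros)
  ultimately have "closure (span V) \<subseteq> {v. inner z v = 0}" by (rule closure_minimal)
  then have "inner z z = 0" unfolding total by blast
  then show ?thesis by (simp add: z_def)
qed

text \<open>Equal Gram matrices make the correspondence \<open>v j \<mapsto> v' j\<close> an isometry.  The proof follows its graph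
  \<open>L\<close>, the span of the pairs \<open>(v j, v' j)\<close>: on \<open>L\<close> both components have the same norm, so a Cauchy
  sequence of first components forces one of second components.\<close>

lemma transport_along_gram:
  fixes v v' :: "'j \<Rightarrow> 'h::{real_inner, complete_space}"
  assumes gram: "\<And>i j. i \<in> J \<Longrightarrow> j \<in> J \<Longrightarrow> inner (v' i) (v' j) = inner (v i) (v j)"
    and total: "closure (span (v ` J)) = UNIV"
  shows "\<exists>y. norm y = norm x \<and> (\<forall>j\<in>J. inner y (v' j) = inner x (v j))"
proof -
  define L where "L = span ((\<lambda>j. (v j, v' j)) ` J)"
  have 1: "inner (snd p) (v' j) = inner (fst p) (v j)" if "p \<in> L" "j \<in> J" for p j
  proof -
    have "L \<subseteq> {p. inner (snd p) (v' j) = inner (fst p) (v j)}"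
      unfolding L_def using gram that
      by (intro span_minimal) (auto simp: subspace_def inner_simps)
    then show ?thesis using that by auto
  qed
  have 2: "norm (snd p) = norm (fst p)" if "p \<in> L" for p
  proof -
    have "L \<subseteq> {q. inner (snd p) (snd q) = inner (fst p) (fst q)}"
      unfolding L_def using 1[OF that]
      by (intro span_minimal) (auto simp: subspace_def inner_simps)
    then show ?thesis using that by (auto simp: norm_eq_sqrt_inner)
  qed
  have "fst ` L = span (v ` J)"
    unfolding L_def by (subst linear_span_image[symmetric]) (auto intro: linear_fst simp: image_image)
  then obtain X where X: "\<And>n. X n \<in> fst ` L" "X \<longlonglongrightarrow> x"
    using total closure_sequential[of x "span (v ` J)"] by auto
  then have "\<exists>Y. \<forall>n. (X n, Y n) \<in> L" by (intro choice) force
  then obtain Y where Y: "\<And>n. (X n, Y n) \<in> L" by blast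
  have "norm (Y m - Y n) = norm (X m - X n)" for m n
  proof -
    have "(X m, Y m) - (X n, Y n) \<in> L"
      using Y unfolding L_def by (intro span_diff) auto
    from 2[OF this] show ?thesis by simp
  qed
  moreover have "Cauchy X" using X(2) by (rule LIMSEQ_imp_Cauchy)
  ultimately have "Cauchy Y" by (simp add: Cauchy_def dist_norm)
  then obtain y where y: "Y \<longlonglongrightarrow> y" using Cauchy_convergent_iff convergent_def by blast
  have "norm (Y n) = norm (X n)" for n using 2[OF Y[of n]] by simp
  then have "norm y = norm x"
    using LIMSEQ_unique[OF tendsto_norm[OF y]] tendsto_norm[OF X(2)] by simp
  moreover have "inner y (v' j) = inner x (v j)" if "j \<in> J" for j
  proof -
    have "(\<lambda>n. inner (Y n) (v' j)) \<longlonglongrightarrow> inner y (v' j)" "(\<lambda>n. inner (X n) (v j)) \<longlonglongrightarrow> inner x (v j)"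
      by (intro tendsto_intros y X(2))+
    moreover have "inner (Y n) (v' j) = inner (X n) (v j)" for n using 1[OF Y that, of n] by simp
    ultimately show ?thesis using LIMSEQ_unique by auto
  qed
  ultimately show ?thesis by blast
qed

text \<open>The operator of \<open>g\<close> sends \<open>x\<close> to the unique \<open>y\<close> whose inner products with the moved family equal those
  of \<open>x\<close> with the original one.  Since \<open>y\<close> is characterised by equations, linearity and
  multiplicativity follow by uniqueness.\<close>

theorem orthogonal_rep_of_action:
  fixes v :: "'j \<Rightarrow> 'h::{real_inner, complete_space}" and G :: "('g, 'm) monoid_scheme" (structure)
  assumes G: "group G"
    and act: "\<And>g j. g \<in> carrier G \<Longrightarrow> j \<in> J \<Longrightarrow> act g j \<in> J" "\<And>j. j \<in> J \<Longrightarrow> act \<one> j = j"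
      "\<And>g h j. g \<in> carrier G \<Longrightarrow> h \<in> carrier G \<Longrightarrow> j \<in> J \<Longrightarrow> act (g \<otimes> h) j = act g (act h j)"
    and gram: "\<And>g i j. g \<in> carrier G \<Longrightarrow> i \<in> J \<Longrightarrow> j \<in> J \<Longrightarrow>
      inner (v (act g i)) (v (act g j)) = inner (v i) (v j)"
    and total: "closure (span (v ` J)) = UNIV"
  obtains \<pi> where "orthogonal_rep G \<pi>"
    "\<And>g j. g \<in> carrier G \<Longrightarrow> j \<in> J \<Longrightarrow> blinfun_apply (\<pi> g) (v j) = v (act g j)"
proof -
  interpret group G by fact
  define P where "P g x y \<longleftrightarrow> (\<forall>j\<in>J. inner y (v (act g j)) = inner x (v j))" for g x y
  have uniq: "y = z" if g: "g \<in> carrier G" and y: "P g x y" "P g x z" for g x y z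
  proof (rule eq_if_inner_eq_on_total[OF total])
    fix w assume "w \<in> v ` J"
    then obtain j where j: "j \<in> J" "w = v j" by blast
    have "act g (act (inv g) j) = j"
      using act(3)[OF g inv_closed[OF g] j(1)] g j act(2) by simp
    moreover have "act (inv g) j \<in> J" using g j act(1) by simp
    ultimately show "inner y w = inner z w" using y j unfolding P_def by metis
  qed
  have ex: "\<exists>y. norm y = norm x \<and> P g x y" if "g \<in> carrier G" for g x
    unfolding P_def using that by (intro transport_along_gram gram total) auto
  define T where "T g x = (THE y. P g x y)" for g x
  have T: "P g x (T g x)" and norm_T: "norm (T g x) = norm x" if g: "g \<in> carrier G" for g x
  proof -
    obtain y where y: "norm y = norm x" "P g x y" using ex[OF g] by blast
    then have "T g x = y" unfolding T_def using uniq[OF g] by blast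
    then show "P g x (T g x)" "norm (T g x) = norm x" using y by auto
  qed
  have T_eq: "T g x = y" if "g \<in> carrier G" "P g x y" for g x y
    using uniq T that by blast
  have lin: "linear (T g)" if g: "g \<in> carrier G" for g
  proof (rule linearI)
    fix x y :: 'h and r :: real
    show "T g (x + y) = T g x + T g y"
      using T[OF g, of x] T[OF g, of y] by (intro T_eq[OF g]) (auto simp: P_def inner_simps)
    show "T g (r *\<^sub>R x) = r *\<^sub>R T g x"
      using T[OF g, of x] by (intro T_eq[OF g]) (auto simp: P_def inner_simps)
  qed
  define \<pi> where "\<pi> g = Blinfun (T g)" for g
  have \<pi>: "blinfun_apply (\<pi> g) = T g" if g: "g \<in> carrier G" for g
    unfolding \<pi>_def
  proof (rule bounded_linear_Blinfun_apply)
    show "bounded_linear (T g)"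
      using lin[OF g] norm_T[OF g]
      by (auto simp: bounded_linear_def bounded_linear_axioms_def intro!: exI[of _ 1])
  qed
  have "orthogonal_rep G \<pi>"
    unfolding orthogonal_rep_def
  proof (intro conjI ballI)
    show "\<pi> \<one> = id_blinfun"
    proof (rule blinfun_eqI)
      fix x show "\<pi> \<one> x = id_blinfun x"
        unfolding \<pi>[OF one_closed] using act(2) by (intro T_eq) (auto simp: P_def)
    qed
    fix g assume g: "g \<in> carrier G"
    show "orthogonal_transformation (\<pi> g)"
      using lin[OF g] norm_T[OF g] by (simp add: \<pi>[OF g] orthogonal_transformation)
    fix h assume h: "h \<in> carrier G"
    show "\<pi> (g \<otimes> h) = \<pi> g o\<^sub>L \<pi> h"
    proof (rule blinfun_eqI)
      fix x
      have "T (g \<otimes> h) x = T g (T h x)"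
        using T[OF g, of "T h x"] T[OF h, of x] g h act by (intro T_eq) (auto simp: P_def)
      then show "\<pi> (g \<otimes> h) x = (\<pi> g o\<^sub>L \<pi> h) x" using g h by (simp add: \<pi>)
    qed
  qed
  moreover have "blinfun_apply (\<pi> g) (v j) = v (act g j)" if "g \<in> carrier G" "j \<in> J" for g j
    unfolding \<pi>[OF that(1)] using that gram by (intro T_eq) (auto simp: P_def)
  ultimately show ?thesis by (rule that[of \<pi>])
qed

text \<open>The Gelfand-Naimark-Segal construction for an invariant kernel on a countable \<open>G\<close>-set \<open>I\<close>.  The
  enumeration \<open>e\<close> may repeat values.\<close>

theorem gns_construction:
  fixes G :: "('g, 'm) monoid_scheme" (structure) and K :: "'i \<Rightarrow> 'i \<Rightarrow> real"
  assumes G: "group G" and I: "I = range e" and K: "psd (\<lambda>m n :: nat. K (e m) (e n))"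
    and act: "\<And>g j. g \<in> carrier G \<Longrightarrow> j \<in> I \<Longrightarrow> act g j \<in> I" "\<And>j. j \<in> I \<Longrightarrow> act \<one> j = j"
      "\<And>g h j. g \<in> carrier G \<Longrightarrow> h \<in> carrier G \<Longrightarrow> j \<in> I \<Longrightarrow> act (g \<otimes> h) j = act g (act h j)"
    and inv: "\<And>g i j. g \<in> carrier G \<Longrightarrow> i \<in> I \<Longrightarrow> j \<in> I \<Longrightarrow> K (act g i) (act g j) = K i j"
  obtains \<pi> and w :: "'i \<Rightarrow> real ell2" where "orthogonal_rep G \<pi>"
    "\<And>i j. i \<in> I \<Longrightarrow> j \<in> I \<Longrightarrow> inner (w i) (w j) = K i j"
    "\<And>g j. g \<in> carrier G \<Longrightarrow> j \<in> I \<Longrightarrow> blinfun_apply (\<pi> g) (w j) = w (act g j)"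
proof -
  obtain w' u :: "nat \<Rightarrow> real ell2" where w': "\<And>i j. inner (w' i) (w' j) = K (e i) (e j)" "\<And>i j. inner (w' i) (u j) = 0"
    "closure (span (range w' \<union> range u)) = UNIV"
    by (rule gram_realization[OF K]) (rule that)
  define w where "w i = w' (inv_into UNIV e i)" for i
  have e_inv: "e (inv_into UNIV e i) = i" if "i \<in> I" for i
    using that by (simp add: I f_inv_into_f)
  have w_e: "w (e n) = w' n" for n
  proof -
    have "e n \<in> I" by (simp add: I)
    then have "inner (w (e n) - w' n) (w (e n) - w' n) = 0"
      by (simp add: w_def inner_simps w' e_inv)
    then show ?thesis by simp
  qed
  have gram: "inner (w i) (w j) = K i j" if "i \<in> I" "j \<in> I" for i j
    using that by (simp add: w_def w' e_inv)
  have range_w: "w ` I = range w'" by (simp add: I image_image w_e)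
  \<comment> \<open>The complementary vectors join the family with the trivial action, which makes it total.\<close>
  define J where "J = Inl ` I \<union> range (Inr :: nat \<Rightarrow> 'i + nat)"
  define act' where "act' g = map_sum (act g) (id :: nat \<Rightarrow> nat)" for g
  define v where "v = case_sum w u"
  have "v ` J = range w' \<union> range u"
    by (simp add: J_def v_def image_Un image_image range_w)
  then have total: "closure (span (v ` J)) = UNIV" using w'(3) by simp
  have wu: "inner (w i) (u k) = 0" for i k by (simp add: w_def w'(2))
  then have uw: "inner (u k) (w i) = 0" for i k by (metis inner_commute)
  obtain \<pi> where \<pi>: "orthogonal_rep G \<pi>"
    "\<And>g j. g \<in> carrier G \<Longrightarrow> j \<in> J \<Longrightarrow> blinfun_apply (\<pi> g) (v j) = v (act' g j)"
  proof (rule orthogonal_rep_of_action[OF G _ _ _ _ total, of act'], goal_cases)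
    case (5 \<pi>)
    from 5(2,3) show ?case by (rule 5(1))
  next
    case (4 g i j)
    then show ?case
      by (auto simp: J_def act'_def v_def wu uw gram inv act(1))
  qed (auto simp: J_def act'_def act)
  have "\<pi> g (w j) = w (act g j)" if "g \<in> carrier G" "j \<in> I" for g j
    using \<pi>(2)[OF that(1), of "Inl j"] that by (simp add: J_def v_def act'_def)
  with \<pi>(1) gram show ?thesis by (rule that[of \<pi> w])
qed

section \<open>Complexification of orthogonal representations\<close>

lift_definition Re_part :: "complex ell2 \<Rightarrow> real ell2" is "\<lambda>x n. Re (x n)"
proof -
  fix x :: "nat \<Rightarrow> complex"
  assume "summable (\<lambda>n. (norm (x n))\<^sup>2)"
  then show "summable (\<lambda>n. (norm (Re (x n)))\<^sup>2)"
    by (rule summable_comparison_test'[where N = 0]) (simp add: cmod_power2)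
qed

lift_definition Im_part :: "complex ell2 \<Rightarrow> real ell2" is "\<lambda>x n. Im (x n)"
proof -
  fix x :: "nat \<Rightarrow> complex"
  assume "summable (\<lambda>n. (norm (x n))\<^sup>2)"
  then show "summable (\<lambda>n. (norm (Im (x n)))\<^sup>2)"
    by (rule summable_comparison_test'[where N = 0]) (simp add: cmod_power2)
qed

lift_definition complex_pair :: "real ell2 \<Rightarrow> real ell2 \<Rightarrow> complex ell2" is "\<lambda>x y n. Complex (x n) (y n)"
  by (simp add: cmod_power2 summable_add)

lemma complex_pair_parts: "complex_pair (Re_part x) (Im_part x) = x"
  by transfer simp

lemma parts_complex_pair: "Re_part (complex_pair x y) = x" "Im_part (complex_pair x y) = y"
  by (transfer, simp)+

lemma complex_pair_add: "complex_pair (a + b) (c + d) = complex_pair a c + complex_pair b d"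
  by transfer (simp add: complex_eq_iff fun_eq_iff)

lemma complex_pair_scaleR: "complex_pair (r *\<^sub>R a) (r *\<^sub>R b) = r *\<^sub>R complex_pair a b"
  by transfer (simp add: complex_eq_iff fun_eq_iff)

lemma parts_add: "Re_part (x + y) = Re_part x + Re_part y" "Im_part (x + y) = Im_part x + Im_part y"
  by (transfer, simp)+

lemma parts_scaleR: "Re_part (r *\<^sub>R x) = r *\<^sub>R Re_part x" "Im_part (r *\<^sub>R x) = r *\<^sub>R Im_part x"
  by (transfer, simp)+

lemma parts_cscale:
  "Re_part (cscale z x) = Re z *\<^sub>R Re_part x - Im z *\<^sub>R Im_part x"
  "Im_part (cscale z x) = Re z *\<^sub>R Im_part x + Im z *\<^sub>R Re_part x"
  by (transfer, simp)+

lemma inner_complex_pair: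
  "inner (complex_pair a b) (complex_pair c d) = inner a c + inner b d"
  by transfer (simp add: inner_complex_def suminf_add square_summable_inner[where 'a = real, simplified])

lemma inner_complex_ell2:
  "inner x y = inner (Re_part x) (Re_part y) + inner (Im_part x) (Im_part y)"
  by (metis inner_complex_pair complex_pair_parts)

definition complexify :: "(real ell2 \<Rightarrow>\<^sub>L real ell2) \<Rightarrow> operator" where
  "complexify T = Blinfun (\<lambda>x. complex_pair (T (Re_part x)) (T (Im_part x)))"

lemma complexify_apply: "complexify T x = complex_pair (T (Re_part x)) (T (Im_part x))"
proof -
  let ?f = "\<lambda>x. complex_pair (T (Re_part x)) (T (Im_part x))"
  have "bounded_linear ?f"
  proof (rule bounded_linear_intro)
    show "?f (x + y) = ?f x + ?f y" for x y
      by (simp add: parts_add blinfun.add_right complex_pair_add)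
    show "?f (r *\<^sub>R x) = r *\<^sub>R ?f x" for r x
      by (simp add: parts_scaleR blinfun.scaleR_right complex_pair_scaleR)
    show "norm (?f x) \<le> norm x * norm T" for x
    proof (rule power2_le_imp_le)
      have "(norm (T v))\<^sup>2 \<le> (norm T)\<^sup>2 * (norm v)\<^sup>2" for v
        using power_mono[OF norm_blinfun[of T v], of 2] by (simp add: power_mult_distrib)
      from add_mono[OF this[of "Re_part x"] this[of "Im_part x"]]
      show "(norm (?f x))\<^sup>2 \<le> (norm x * norm T)\<^sup>2"
        unfolding power_mult_distrib power2_norm_eq_inner inner_complex_pair
          inner_complex_ell2[of x x]
        by (simp add: algebra_simps)
    qed simp
  qed
  then show ?thesis by (simp add: complexify_def bounded_linear_Blinfun_apply)
qed

lemma orthogonal_rep_isometric: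
  assumes "orthogonal_rep G \<pi>" "g \<in> carrier G"
  shows "norm (\<pi> g x) = norm x" and "inner (\<pi> g x) (\<pi> g y) = inner x y"
  using assms by (auto simp: orthogonal_rep_def orthogonal_transformation_def norm_eq_sqrt_inner)

text \<open>Kernels produce real representations, while the C*-algebra sees complex ones.  The real inner
  product on the complexification is that of an orthogonal direct sum of two copies of the real space.\<close>

theorem complexification:
  assumes \<pi>: "orthogonal_rep G \<pi>"
  shows "unitary_rep G (\<lambda>g. complexify (\<pi> g))"
  unfolding unitary_rep_def orthogonal_rep_def
proof (intro conjI ballI allI)
  show "complexify (\<pi> \<one>\<^bsub>G\<^esub>) = id_blinfun"
    using \<pi> by (intro blinfun_eqI) (simp add: orthogonal_rep_def complexify_apply complex_pair_parts)
  show "complexify (\<pi> (g \<otimes>\<^bsub>G\<^esub> h)) = complexify (\<pi> g) o\<^sub>L complexify (\<pi> h)"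
    if "g \<in> carrier G" "h \<in> carrier G" for g h
    using \<pi> that
    by (intro blinfun_eqI) (simp add: orthogonal_rep_def complexify_apply parts_complex_pair)
  fix g assume g: "g \<in> carrier G"
  show "orthogonal_transformation (complexify (\<pi> g))"
    unfolding orthogonal_transformation_def
    by (simp add: complexify_apply inner_complex_pair orthogonal_rep_isometric[OF \<pi> g]
        inner_complex_ell2[symmetric] blinfun.bounded_linear_right bounded_linear.linear)
  show "complexify (\<pi> g) o\<^sub>L cscalar z = cscalar z o\<^sub>L complexify (\<pi> g)" for z
  proof (rule blinfun_eqI)
    fix x
    let ?l = "(complexify (\<pi> g) o\<^sub>L cscalar z) x" and ?r = "(cscalar z o\<^sub>L complexify (\<pi> g)) x"
    have "Re_part ?l = Re_part ?r" "Im_part ?l = Im_part ?r"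
      by (simp_all add: complexify_apply cscalar.rep_eq parts_complex_pair parts_cscale
          blinfun.add_right blinfun.diff_right blinfun.scaleR_right)
    then show "?l = ?r" by (metis complex_pair_parts)
  qed
qed

section \<open>Spectral gaps of self-adjoint operators\<close>

text \<open>The Cauchy-Schwarz inequality for the semidefinite form of \<open>P\<close>, evaluated at \<open>x\<close> and \<open>P x\<close>.  Consequently
  vectors on which the form is small are almost in the kernel of \<open>P\<close>.\<close>

lemma norm_square_le_of_nonneg_form:
  fixes P :: "'h::real_inner \<Rightarrow>\<^sub>L 'h"
  assumes sym: "\<And>x y. inner (P x) y = inner x (P y)" and pos: "\<And>x. 0 \<le> inner (P x) x"
  shows "(norm (P x))\<^sup>2 \<le> (norm P + 1) * inner (P x) x"
proof -
  \<comment> \<open>Adding \<open>1\<close> makes the bound positive even if \<open>P = 0\<close>, so that it can be inverted.\<close>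
  define M where "M = norm P + 1"
  have M: "M > 0" unfolding M_def using norm_ge_zero[of P] by linarith
  define t where "t = 1 / M"
  have tM: "t * M = 1" and t: "t > 0" using M by (simp_all add: t_def)
  define y where "y = P x"
  have "inner (P y) y \<le> norm (P y) * norm y" by (rule norm_cauchy_schwarz)
  also have "\<dots> \<le> (M * norm y) * norm y"
    using norm_blinfun[of P y]
    by (intro mult_right_mono) (auto simp: M_def distrib_right add_increasing2)
  finally have "inner (P y) y \<le> M * (norm y)\<^sup>2" by (simp add: power2_eq_square)
  then have "t * t * inner (P y) y \<le> t * t * (M * (norm y)\<^sup>2)"
    using t by (intro mult_left_mono) auto
  also have "\<dots> = t * (norm y)\<^sup>2" using tM by simp
  finally have 1: "t * t * inner (P y) y \<le> t * (norm y)\<^sup>2" .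
  have "0 \<le> inner (P (x - t *\<^sub>R y)) (x - t *\<^sub>R y)" by (rule pos)
  also have "\<dots> = inner (P x) x - t * inner y y - t * inner (P y) x + t * t * inner (P y) y"
    by (simp add: blinfun.diff_right blinfun.scaleR_right inner_simps y_def algebra_simps)
  also have "inner (P y) x = (norm y)\<^sup>2"
    by (simp add: sym y_def power2_norm_eq_inner)
  finally have "t * (norm y)\<^sup>2 \<le> inner (P x) x"
    using 1 by (simp add: power2_norm_eq_inner)
  then have "M * (t * (norm y)\<^sup>2) \<le> M * inner (P x) x" using M by simp
  then show ?thesis using tM by (simp add: M_def y_def mult.assoc[symmetric] mult.commute)
qed

text \<open>With \<open>a = e / 2\<close> and \<open>B = T - a\<close>, the claim says that \<open>norm (B x) \<ge> a * norm x\<close>.  Otherwise the infimum \<open>m\<close> of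
  \<open>(norm (B x))\<^sup>2\<close> over the unit sphere is less than \<open>a\<^sup>2\<close>.  The form of \<open>P = B\<^sup>2 - m\<close> is nonnegative and
  comes arbitrarily close to \<open>0\<close> on unit vectors, so \<open>P\<close> has no bounded left inverse; but \<open>P\<close> is the product of \<open>B - r\<close> and
  \<open>B + r\<close> with \<open>r = sqrt m < a\<close>, and both factors have one.\<close>

theorem spectral_inequality_of_left_inverses:
  fixes T :: "'h::real_inner \<Rightarrow>\<^sub>L 'h"
  assumes sym: "\<And>x y. inner (T x) y = inner x (T y)" and e: "0 < e"
    and inv: "\<And>t. 0 < t \<Longrightarrow> t < e \<Longrightarrow> \<exists>R. \<forall>x. blinfun_apply R (t *\<^sub>R x - T x) = x"
  shows "e * inner (T x) x \<le> (norm (T x))\<^sup>2"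
proof -
  define a where "a = e / 2"
  have a: "a > 0" using e by (simp add: a_def)
  define B where "B = T - a *\<^sub>R id_blinfun"
  have B_apply: "B x = T x - a *\<^sub>R x" for x
    by (simp add: B_def blinfun.diff_left blinfun.scaleR_left)
  have B_sym: "inner (B x) y = inner x (B y)" for x y
    by (simp add: B_apply inner_simps sym)
  have key: "a * norm x \<le> norm (B x)" for x
  proof (rule ccontr)
    assume "\<not> a * norm x \<le> norm (B x)"
    then have lt: "norm (B x) < a * norm x" by simp
    then have x0: "norm x > 0" by auto
    define X where "X = (\<lambda>y. (norm (B y))\<^sup>2) ` {y. norm y = 1}"
    define m where "m = Inf X"
    have bdd: "bdd_below X" unfolding X_def by (intro bdd_belowI[of _ 0]) auto
    let ?u = "(1 / norm x) *\<^sub>R x"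
    have u: "norm ?u = 1" using x0 by simp
    have uX: "(norm (B ?u))\<^sup>2 \<in> X" unfolding X_def using u by blast
    have "norm (B ?u) = norm (B x) / norm x" by (simp add: blinfun.scaleR_right)
    also have "\<dots> < a" using lt x0 by (simp add: field_simps)
    finally have "(norm (B ?u))\<^sup>2 < a\<^sup>2" by (intro power_strict_mono) auto
    then have m_lt: "m < a\<^sup>2" using cInf_lower[OF uX bdd] by (simp add: m_def)
    have m0: "0 \<le> m" unfolding m_def using uX by (intro cInf_greatest) (auto simp: X_def)
    define r where "r = sqrt m"
    have r: "0 \<le> r" "r * r = m" "r < a"
      using m0 m_lt a real_sqrt_less_mono[OF m_lt] by (auto simp: r_def)
    have lower: "m * (norm y)\<^sup>2 \<le> (norm (B y))\<^sup>2" for y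
    proof (cases "y = 0")
      case False
      let ?v = "(1 / norm y) *\<^sub>R y"
      have "(norm (B ?v))\<^sup>2 \<in> X" unfolding X_def using False by (intro imageI) simp
      then have "m \<le> (norm (B ?v))\<^sup>2" unfolding m_def by (rule cInf_lower[OF _ bdd])
      then show ?thesis using False by (simp add: blinfun.scaleR_right power_divide field_simps)
    qed simp
    define P where "P = (B o\<^sub>L B) - m *\<^sub>R id_blinfun"
    have P_apply: "P y = B (B y) - m *\<^sub>R y" for y
      by (simp add: P_def blinfun.diff_left blinfun.scaleR_left)
    have form: "inner (P y) y = (norm (B y))\<^sup>2 - m * (norm y)\<^sup>2" for y
      by (simp add: P_apply inner_simps B_sym power2_norm_eq_inner)
    have P_bound: "(norm (P y))\<^sup>2 \<le> (norm P + 1) * inner (P y) y" for y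
    proof (rule norm_square_le_of_nonneg_form)
      show "inner (P y) z = inner y (P z)" for y z by (simp add: P_apply inner_simps B_sym)
      show "0 \<le> inner (P y) y" for y using lower[of y] by (simp add: form)
    qed
    obtain R1 where R1: "\<And>y. blinfun_apply R1 ((a + r) *\<^sub>R y - T y) = y"
      using inv[of "a + r"] r a by (auto simp: a_def)
    obtain R2 where R2: "\<And>y. blinfun_apply R2 ((a - r) *\<^sub>R y - T y) = y"
      using inv[of "a - r"] r a by (auto simp: a_def)
    define R where "R = R2 o\<^sub>L R1"
    have R: "R (P y) = y" for y
    proof -
      let ?z = "(a - r) *\<^sub>R y - T y"
      have "(a + r) *\<^sub>R ?z - T ?z = P y"
        by (simp add: P_apply B_apply blinfun.add_right blinfun.diff_right blinfun.scaleR_right r(2)[symmetric]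
            algebra_simps)
      then show ?thesis using R1[of ?z] R2[of y] by (simp add: R_def)
    qed
    \<comment> \<open>A bounded left inverse of \<open>P\<close> keeps its form at least \<open>\<kappa>\<close> on unit vectors, contradicting the choice of \<open>m\<close>.\<close>
    define \<kappa> where "\<kappa> = 1 / ((norm R + 1)\<^sup>2 * (norm P + 1))"
    have pos: "0 < norm R + 1" "0 < norm P + 1"
      using norm_ge_zero[of R] norm_ge_zero[of P] by linarith+
    then have \<kappa>: "\<kappa> > 0" by (simp add: \<kappa>_def)
    have "m + \<kappa> \<le> (norm (B y))\<^sup>2" if y: "norm y = 1" for y
    proof -
      have "norm y \<le> norm R * norm (P y)" using norm_blinfun[of R "P y"] by (simp add: R)
      also have "\<dots> \<le> (norm R + 1) * norm (P y)" by (intro mult_right_mono) auto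
      finally have "1 \<le> (norm R + 1) * norm (P y)" using y by simp
      then have "1 \<le> ((norm R + 1) * norm (P y))\<^sup>2" by (simp add: one_le_power)
      also have "\<dots> \<le> (norm R + 1)\<^sup>2 * ((norm P + 1) * inner (P y) y)"
        unfolding power_mult_distrib by (intro mult_left_mono P_bound) simp
      finally have "\<kappa> \<le> inner (P y) y"
        using pos by (simp add: \<kappa>_def divide_le_eq mult_ac)
      then show ?thesis using y by (simp add: form)
    qed
    then have "z \<ge> m + \<kappa>" if "z \<in> X" for z
      using that by (auto simp: X_def)
    moreover have "X \<noteq> {}" using uX by blast
    ultimately have "m + \<kappa> \<le> Inf X" by (intro cInf_greatest)
    then show False using \<kappa> by (simp add: m_def)
  qed
  have "(a * norm x)\<^sup>2 \<le> (norm (B x))\<^sup>2" using a by (intro power_mono key) auto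
  then show ?thesis
    unfolding power_mult_distrib power2_norm_eq_inner B_apply
    by (simp add: inner_simps inner_commute a_def power2_eq_square algebra_simps)
qed

text \<open>Here \<open>y\<close> stands for \<open>T x\<close>.  The distance of \<open>t\<close> from the complement of \<open>{0<..<\<eta>}\<close> is the lower bound
  for \<open>T - t\<close> which spectral calculus predicts.\<close>

lemma bounded_below_of_spectral_inequality:
  fixes y x :: "'h::real_inner"
  assumes t: "0 < t" "t < \<eta>" and ineq: "\<eta> * inner y x \<le> (norm y)\<^sup>2"
  shows "(min t (\<eta> - t))\<^sup>2 * (norm x)\<^sup>2 \<le> (norm (t *\<^sub>R x - y))\<^sup>2"
proof -
  define A p n where "A = (norm y)\<^sup>2" and "p = inner y x" and "n = (norm x)\<^sup>2"
  have A: "0 \<le> A" "\<eta> * p \<le> A" using ineq by (simp_all add: A_def p_def)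
  have expand: "(norm (s *\<^sub>R x - y))\<^sup>2 = A - 2 * s * p + s\<^sup>2 * n" for s
    unfolding A_def p_def n_def power2_norm_eq_inner
    by (simp add: inner_simps inner_commute power2_eq_square algebra_simps)
  show ?thesis
  proof (cases "2 * t \<le> \<eta>")
    case True
    have "2 * t * (\<eta> * p) \<le> 2 * t * A" using A t by (intro mult_left_mono) auto
    also have "\<dots> \<le> \<eta> * A" using A True by (intro mult_right_mono) auto
    finally have "\<eta> * (2 * t * p) \<le> \<eta> * A" by (simp add: mult_ac)
    then have "2 * t * p \<le> A" using t by simp
    moreover have "min t (\<eta> - t) = t" using True by simp
    ultimately show ?thesis unfolding expand by (simp add: n_def)
  next
    case False
    have m: "min t (\<eta> - t) = \<eta> - t" using False by simp
    have nonneg: "0 \<le> A - 2 * \<eta> * p + \<eta>\<^sup>2 * n" unfolding expand[symmetric] by simp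
    \<comment> \<open>\<open>\<eta> * ((T - t)\<^sup>2 - (\<eta> - t)\<^sup>2)\<close> is a combination of \<open>T\<^sup>2 - \<eta> T\<close> and \<open>(T - \<eta>)\<^sup>2\<close> with nonnegative
      coefficients.\<close>
    have "0 \<le> 2 * (\<eta> - t) * (A - \<eta> * p) + (2 * t - \<eta>) * (A - 2 * \<eta> * p + \<eta>\<^sup>2 * n)"
      using A t False nonneg by (intro add_nonneg_nonneg[OF mult_nonneg_nonneg mult_nonneg_nonneg]) simp_all
    also have "\<dots> = \<eta> * (A - 2 * t * p + t\<^sup>2 * n - (\<eta> - t)\<^sup>2 * n)"
      by (simp add: power2_eq_square algebra_simps)
    finally have "0 \<le> A - 2 * t * p + t\<^sup>2 * n - (\<eta> - t)\<^sup>2 * n"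
      using t by (simp add: zero_le_mult_iff)
    then show ?thesis unfolding expand m by (simp add: n_def)
  qed
qed

section \<open>Invertibility in the maximal group C*-algebra\<close>

lemma cscalar_of_real: "cscalar (complex_of_real r) = r *\<^sub>R id_blinfun"
  by (rule blinfun_eqI, simp add: cscalar.rep_eq blinfun.scaleR_left, transfer)
    (simp add: scaleR_conv_of_real)

lemma cscalar_of_real_compose: "cscalar (complex_of_real r) o\<^sub>L a = r *\<^sub>R a"
  by (rule blinfun_eqI) (simp add: cscalar_of_real blinfun.scaleR_left)

lemma cstar_max_scaleR_closed:
  "a \<in> carrier (cstar_max G) \<Longrightarrow> (\<lambda>U. r *\<^sub>R a U) \<in> carrier (cstar_max G)"
  using cstar_max_smult_closed[of a G "complex_of_real r"] by (simp add: cscalar_of_real_compose)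

lemma cstar_max_diff_closed:
  assumes "a \<in> carrier (cstar_max G)" "b \<in> carrier (cstar_max G)"
  shows "(\<lambda>U. a U - b U) \<in> carrier (cstar_max G)"
  using cstar_max_add_closed[OF assms(1) cstar_max_scaleR_closed[OF assms(2), of "-1"]] by simp

lemma cstar_max_uniform_limit_closed:
  assumes zero: "\<And>U. \<not> unitary_rep G U \<Longrightarrow> a U = 0"
    and lim: "\<And>e. 0 < e \<Longrightarrow> \<exists>b\<in>carrier (cstar_max G). \<forall>U. unitary_rep G U \<longrightarrow> norm (a U - b U) \<le> e"
  shows "a \<in> carrier (cstar_max G)"
  unfolding cstar_max_carrier_iff
proof (intro conjI allI impI)
  fix e :: real assume e: "0 < e"
  obtain b where b: "b \<in> carrier (cstar_max G)" "\<And>U. unitary_rep G U \<Longrightarrow> norm (a U - b U) \<le> e / 2"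
    using lim[of "e / 2"] e by auto
  obtain f where f: "f \<in> group_algebra G" "\<And>U. unitary_rep G U \<Longrightarrow> norm (b U - extend_rep U f) \<le> e / 2"
    using b(1) half_gt_zero[OF e] by (rule cstar_max_approx) blast
  have "norm (a U - extend_rep U f) \<le> e" if "unitary_rep G U" for U
    using norm_triangle_ineq[of "a U - b U" "b U - extend_rep U f"] b(2)[OF that] f(2)[OF that] by simp
  with f(1) show "\<exists>f\<in>group_algebra G. \<forall>U. unitary_rep G U \<longrightarrow> norm (a U - extend_rep U f) \<le> e"
    by blast
qed (rule zero)

primrec blinfun_power :: "('h::real_normed_vector \<Rightarrow>\<^sub>L 'h) \<Rightarrow> nat \<Rightarrow> 'h \<Rightarrow>\<^sub>L 'h" where
  "blinfun_power X 0 = id_blinfun"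
| "blinfun_power X (Suc n) = X o\<^sub>L blinfun_power X n"

lemma blinfun_power_Suc_right: "blinfun_power X n o\<^sub>L X = blinfun_power X (Suc n)"
  by (induction n) (simp_all add: id_blinfun_compose compose_id_blinfun blinfun_compose_assoc)

lemma norm_blinfun_power_le: "norm X \<le> q \<Longrightarrow> norm (blinfun_power X n) \<le> q ^ n"
proof (induction n)
  case 0 show ?case by (simp add: norm_blinfun_id_le)
next
  case (Suc n)
  have "norm (blinfun_power X (Suc n)) \<le> norm X * norm (blinfun_power X n)"
    by (simp add: norm_blinfun_compose)
  also have "\<dots> \<le> q * q ^ n"
    using Suc order.trans[OF norm_ge_zero Suc.prems] by (intro mult_mono) auto
  finally show ?case by simp
qed

lemma neumann_series:
  fixes X :: "'h::banach \<Rightarrow>\<^sub>L 'h"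
  assumes X: "norm X \<le> q" and q: "q < 1"
  defines "N \<equiv> \<Sum>n. blinfun_power X n"
  shows "N o\<^sub>L (id_blinfun - X) = id_blinfun" and "(id_blinfun - X) o\<^sub>L N = id_blinfun"
    and "norm (N - (\<Sum>n<k. blinfun_power X n)) \<le> q ^ k / (1 - q)"
proof -
  interpret c: bounded_bilinear "(o\<^sub>L) :: ('h \<Rightarrow>\<^sub>L 'h) \<Rightarrow> ('h \<Rightarrow>\<^sub>L 'h) \<Rightarrow> ('h \<Rightarrow>\<^sub>L 'h)"
    by (rule bounded_bilinear_blinfun_compose)
  have q0: "0 \<le> q" using X norm_ge_zero order.trans by blast
  have geo: "summable (\<lambda>n. q ^ n)" using q0 q by (simp add: summable_geometric)
  have sum: "summable (blinfun_power X)"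
    using norm_blinfun_power_le[OF X] by (intro summable_comparison_test'[OF geo]) auto
  have tail: "(\<Sum>n. blinfun_power X (Suc n)) = N - id_blinfun"
    unfolding N_def using suminf_split_head[OF sum] by simp
  have "N o\<^sub>L X = (\<Sum>n. blinfun_power X n o\<^sub>L X)"
    unfolding N_def by (rule bounded_linear.suminf[OF c.bounded_linear_left sum])
  then have "N o\<^sub>L X = N - id_blinfun" by (simp only: blinfun_power_Suc_right tail)
  then show "N o\<^sub>L (id_blinfun - X) = id_blinfun" by (simp add: c.diff_right compose_id_blinfun)
  have "X o\<^sub>L N = (\<Sum>n. X o\<^sub>L blinfun_power X n)"
    unfolding N_def by (rule bounded_linear.suminf[OF c.bounded_linear_right sum])
  then have "X o\<^sub>L N = N - id_blinfun" by (simp add: tail[symmetric])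
  then show "(id_blinfun - X) o\<^sub>L N = id_blinfun" by (simp add: c.diff_left id_blinfun_compose)
  have "N - (\<Sum>n<k. blinfun_power X n) = (\<Sum>n. blinfun_power X (n + k))"
    unfolding N_def using suminf_minus_initial_segment[OF sum, of k] by simp
  also have "norm \<dots> \<le> (\<Sum>n. q ^ (n + k))"
    using norm_blinfun_power_le[OF X] summable_ignore_initial_segment[OF geo, of k]
    by (intro norm_suminf_le) auto
  also have "\<dots> = q ^ k / (1 - q)"
    using q0 q geo by (simp add: power_add suminf_mult2[symmetric] suminf_geometric)
  finally show "norm (N - (\<Sum>n<k. blinfun_power X n)) \<le> q ^ k / (1 - q)" .
qed

text \<open>The inverse belongs to the C*-algebra, and not only to each representation separately, because
  the error of the partial sums is bounded independently of the representation.\<close>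

lemma cstar_max_neumann_inverse:
  assumes G: "group G" and C: "C \<in> carrier (cstar_max G)" and q: "q < 1"
    and le: "\<And>U. unitary_rep G U \<Longrightarrow> norm (C U) \<le> q" and q0: "0 \<le> q"
  obtains N where "N \<in> carrier (cstar_max G)"
    "\<And>U. unitary_rep G U \<Longrightarrow> N U o\<^sub>L (id_blinfun - C U) = id_blinfun"
    "\<And>U. unitary_rep G U \<Longrightarrow> (id_blinfun - C U) o\<^sub>L N U = id_blinfun"
proof -
  define pow where "pow n U = (if unitary_rep G U then blinfun_power (C U) n else 0)" for n U
  have C0: "C U = 0" if "\<not> unitary_rep G U" for U
    using C that by (simp add: cstar_max_carrier_iff)
  have pow: "pow n \<in> carrier (cstar_max G)" for n
  proof (induction n)
    case 0
    have "pow 0 = \<one>\<^bsub>cstar_max G\<^esub>" by (simp add: pow_def cstar_max_def fun_eq_iff)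
    then show ?case using cstar_max_one_closed[OF G] by simp
  next
    case (Suc n)
    have "pow (Suc n) = (\<lambda>U. C U o\<^sub>L pow n U)" by (simp add: pow_def fun_eq_iff C0)
    then show ?case using cstar_max_mult_closed[OF G C Suc] by simp
  qed
  have partial: "(\<lambda>U. \<Sum>n<k. pow n U) \<in> carrier (cstar_max G)" for k
  proof (induction k)
    case 0
    show ?case using cstar_max_scaleR_closed[OF C, of 0] by simp
  next
    case (Suc k)
    then show ?case using cstar_max_add_closed[OF Suc pow[of k]] by simp
  qed
  define N where "N U = (if unitary_rep G U then \<Sum>n. blinfun_power (C U) n else 0)" for U
  have "N \<in> carrier (cstar_max G)"
  proof (rule cstar_max_uniform_limit_closed)
    fix e :: real assume e: "0 < e"
    have "(\<lambda>k. q ^ k / (1 - q)) \<longlonglongrightarrow> 0 / (1 - q)"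
      using q q0 by (intro tendsto_intros LIMSEQ_realpow_zero) auto
    then have "\<forall>\<^sub>F k in sequentially. q ^ k / (1 - q) < e" using e by (intro order_tendstoD(2)) auto
    then obtain k where k: "q ^ k / (1 - q) < e" by (auto simp: eventually_sequentially)
    have "norm (N U - (\<Sum>n<k. pow n U)) \<le> e" if U: "unitary_rep G U" for U
      using neumann_series(3)[OF le[OF U] q, of k] k U by (simp add: N_def pow_def)
    then show "\<exists>b\<in>carrier (cstar_max G). \<forall>U. unitary_rep G U \<longrightarrow> norm (N U - b U) \<le> e"
      by (intro bexI[OF _ partial[of k]]) simp
  qed (simp add: N_def)
  then show ?thesis
    by (rule that[of N]) (simp_all add: N_def neumann_series(1,2)[OF le q])
qed

text \<open>A self-adjoint element \<open>B\<close> with \<open>\<delta> \<le> \<bar>B\<bar> \<le> M\<close> satisfies \<open>0 \<le> 1 - (B / M)\<^sup>2 \<le> 1 - (\<delta> / M)\<^sup>2 < 1\<close>, so the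
  square of \<open>B\<close> is inverted by a Neumann series.  Then \<open>B\<close> has a left and a right inverse.\<close>

lemma cstar_max_unit_if_bounded_below:
  assumes G: "group G" and B: "B \<in> carrier (cstar_max G)"
    and sym: "\<And>U x y. unitary_rep G U \<Longrightarrow> inner (B U x) y = inner x (B U y)"
    and lower: "\<And>U x. unitary_rep G U \<Longrightarrow> \<delta> * norm x \<le> norm (B U x)" and \<delta>: "0 < \<delta>" "\<delta> \<le> M"
    and upper: "\<And>U x. unitary_rep G U \<Longrightarrow> norm (B U x) \<le> M * norm x"
  shows "B \<in> Units (cstar_max G)"
proof -
  interpret R: ring "cstar_max G" by (rule ring_cstar_max[OF G])
  interpret c: bounded_bilinear "(o\<^sub>L) :: operator \<Rightarrow> operator \<Rightarrow> operator"
    by (rule bounded_bilinear_blinfun_compose)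
  have M: "M > 0" using \<delta> by simp
  define r where "r = 1 / M\<^sup>2"
  have r: "r > 0" "r * M\<^sup>2 = 1" using M by (simp_all add: r_def)
  have B0: "B U = 0" if "\<not> unitary_rep G U" for U
    using B that by (simp add: cstar_max_carrier_iff)
  define C where "C U = \<one>\<^bsub>cstar_max G\<^esub> U - r *\<^sub>R (B U o\<^sub>L B U)" for U
  have C: "C \<in> carrier (cstar_max G)"
    unfolding C_def
    by (intro cstar_max_diff_closed cstar_max_scaleR_closed cstar_max_mult_closed G B cstar_max_one_closed)
  have CU: "id_blinfun - C U = r *\<^sub>R (B U o\<^sub>L B U)" if "unitary_rep G U" for U
    using that by (simp add: C_def cstar_max_def)
  define q where "q = sqrt (1 - r * \<delta>\<^sup>2)"
  have "r * \<delta>\<^sup>2 \<le> r * M\<^sup>2" using \<delta> r by (intro mult_left_mono power_mono) auto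
  then have rd: "0 \<le> 1 - r * \<delta>\<^sup>2" "1 - r * \<delta>\<^sup>2 < 1" using r \<delta> by auto
  then have q: "0 \<le> q" "q < 1" "q\<^sup>2 = 1 - r * \<delta>\<^sup>2" by (simp_all add: q_def)
  have C_le: "norm (C U) \<le> q" if U: "unitary_rep G U" for U
  proof (rule norm_blinfun_bound)
    fix x
    let ?y = "B U x"
    have Cx: "C U x = x - r *\<^sub>R B U ?y"
      using U by (simp add: C_def cstar_max_def blinfun.diff_left blinfun.scaleR_left)
    have expand: "(norm (v - r *\<^sub>R w))\<^sup>2 = (norm v)\<^sup>2 - 2 * r * inner v w + r * r * (norm w)\<^sup>2"
      for v w :: "complex ell2"
      unfolding power2_norm_eq_inner by (simp add: inner_simps inner_commute algebra_simps)
    have "inner x (B U ?y) = (norm ?y)\<^sup>2"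
      unfolding power2_norm_eq_inner by (rule sym[OF U, symmetric])
    then have 1: "(norm (C U x))\<^sup>2 = (norm x)\<^sup>2 - 2 * r * (norm ?y)\<^sup>2 + r * r * (norm (B U ?y))\<^sup>2"
      unfolding Cx expand by simp
    have "r * r * (norm (B U ?y))\<^sup>2 \<le> r * r * (M * norm ?y)\<^sup>2"
      using upper[OF U, of ?y] r by (intro mult_left_mono power_mono) auto
    also have "r * r * (M * norm ?y)\<^sup>2 = (r * M\<^sup>2) * (r * (norm ?y)\<^sup>2)"
      by (simp add: power_mult_distrib)
    finally have 2: "r * r * (norm (B U ?y))\<^sup>2 \<le> r * (norm ?y)\<^sup>2" unfolding r(2) by simp
    have "r * (\<delta> * norm x)\<^sup>2 \<le> r * (norm ?y)\<^sup>2"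
      using lower[OF U, of x] r(1) \<delta> by (intro mult_left_mono power_mono) auto
    moreover have "(q * norm x)\<^sup>2 = (norm x)\<^sup>2 - r * (\<delta> * norm x)\<^sup>2"
      by (simp add: power_mult_distrib q(3) algebra_simps)
    ultimately have "(norm (C U x))\<^sup>2 \<le> (q * norm x)\<^sup>2" using 1 2 by linarith
    then show "norm (C U x) \<le> q * norm x" by (rule power2_le_imp_le) (simp add: q)
  qed (rule q)
  obtain N where N: "N \<in> carrier (cstar_max G)"
    "\<And>U. unitary_rep G U \<Longrightarrow> N U o\<^sub>L (id_blinfun - C U) = id_blinfun"
    "\<And>U. unitary_rep G U \<Longrightarrow> (id_blinfun - C U) o\<^sub>L N U = id_blinfun"
    by (rule cstar_max_neumann_inverse[OF G C q(2) C_le q(1)], assumption, rule that)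
  define L where "L = (\<lambda>U. r *\<^sub>R (N U o\<^sub>L B U))"
  define L' where "L' = (\<lambda>U. r *\<^sub>R (B U o\<^sub>L N U))"
  have closed: "L \<in> carrier (cstar_max G)" "L' \<in> carrier (cstar_max G)"
    unfolding L_def L'_def by (intro cstar_max_scaleR_closed cstar_max_mult_closed G B N(1))+
  have "L U o\<^sub>L B U = \<one>\<^bsub>cstar_max G\<^esub> U \<and> B U o\<^sub>L L' U = \<one>\<^bsub>cstar_max G\<^esub> U" for U
  proof (cases "unitary_rep G U")
    case True
    have "L U o\<^sub>L B U = N U o\<^sub>L (id_blinfun - C U)" "B U o\<^sub>L L' U = (id_blinfun - C U) o\<^sub>L N U"
      unfolding CU[OF True] L_def L'_def c.scaleR_left c.scaleR_right blinfun_compose_assoc by simp_all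
    then show ?thesis using N(2,3)[OF True] True by (simp add: cstar_max_def)
  next
    case False
    then show ?thesis by (simp add: B0 cstar_max_def)
  qed
  then have left: "L \<otimes>\<^bsub>cstar_max G\<^esub> B = \<one>\<^bsub>cstar_max G\<^esub>"
    and right: "B \<otimes>\<^bsub>cstar_max G\<^esub> L' = \<one>\<^bsub>cstar_max G\<^esub>"
    by (simp_all add: cstar_max_def fun_eq_iff)
  have "L = L \<otimes>\<^bsub>cstar_max G\<^esub> (B \<otimes>\<^bsub>cstar_max G\<^esub> L')"
    unfolding right by (rule R.r_one[OF closed(1), symmetric])
  also have "\<dots> = (L \<otimes>\<^bsub>cstar_max G\<^esub> B) \<otimes>\<^bsub>cstar_max G\<^esub> L'"
    by (rule R.m_assoc[OF closed(1) B closed(2), symmetric])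
  also have "\<dots> = L'" unfolding left by (rule R.l_one[OF closed(2)])
  finally have "B \<otimes>\<^bsub>cstar_max G\<^esub> L = \<one>\<^bsub>cstar_max G\<^esub>" using right by simp
  then show ?thesis
    unfolding Units_def using left B closed(1) by (intro CollectI conjI bexI[of _ L])
qed

section \<open>The spectrum of the Laplacian\<close>

definition laplacian_op :: "'g set \<Rightarrow> ('g \<Rightarrow> 'h::real_normed_vector \<Rightarrow>\<^sub>L 'h) \<Rightarrow> 'h \<Rightarrow>\<^sub>L 'h" where
  "laplacian_op S U = (\<Sum>s\<in>S. id_blinfun - U s)"

lemma laplacian_op_apply: "laplacian_op S U x = (\<Sum>s\<in>S. x - U s x)"
  by (simp add: laplacian_op_def blinfun.sum_left blinfun.diff_left)

lemma extend_rep_laplacian: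
  assumes "finite S" and one: "U \<one>\<^bsub>G\<^esub> = id_blinfun"
  shows "extend_rep U (\<lambda>h. complex_of_real (laplacian G S h)) = laplacian_op S U"
proof -
  let ?B = "insert \<one>\<^bsub>G\<^esub> S"
  have 1: "(\<Sum>s\<in>S. group_elem s h) = (if h \<in> S then 1 else 0)" for h
    using assms by (simp add: group_elem_def)
  have fin: "finite ?B" using assms by simp
  have lap: "laplacian G S h = real (card S) * (if h = \<one>\<^bsub>G\<^esub> then 1 else 0) - (if h \<in> S then 1 else 0)" for h
    unfolding laplacian_def 1 by (simp add: group_elem_def)
  have "{h. complex_of_real (laplacian G S h) \<noteq> 0} \<subseteq> ?B"
    by (auto simp: lap)
  then have "extend_rep U (\<lambda>h. complex_of_real (laplacian G S h))
      = (\<Sum>h\<in>?B. laplacian G S h *\<^sub>R U h)"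
    using extend_rep_superset[OF fin] by (simp only: cscalar_of_real_compose)
  also have "\<dots> = (\<Sum>h\<in>?B. (if h = \<one>\<^bsub>G\<^esub> then real (card S) *\<^sub>R U h else 0) - (if h \<in> S then U h else 0))"
    by (intro sum.cong) (auto simp: lap algebra_simps)
  also have "\<dots> = real (card S) *\<^sub>R id_blinfun - (\<Sum>h\<in>?B. if h \<in> S then U h else 0)"
    using fin one by (simp add: sum_subtractf)
  also have "(\<Sum>h\<in>?B. if h \<in> S then U h else 0) = (\<Sum>h\<in>S. U h)"
    using fin by (intro sum.mono_neutral_cong_right) auto
  finally show ?thesis by (simp add: laplacian_op_def sum_subtractf sum_constant_scaleR)
qed

lemma orthogonal_rep_adjoint:
  fixes G :: "('g, 'm) monoid_scheme" (structure)
  assumes "group G" and "orthogonal_rep G \<pi>" "g \<in> carrier G"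
  shows "inner (\<pi> g x) y = inner x (\<pi> (inv g) y)"
proof -
  interpret group G by fact
  have "\<pi> g (\<pi> (inv g) y) = y"
    using assms unfolding orthogonal_rep_def
    by (metis blinfun_apply_blinfun_compose blinfun_apply_id_blinfun id_apply inv_closed r_inv)
  then show ?thesis
    using orthogonal_rep_isometric(2)[OF assms(2,3), of x "\<pi> (inv g) y"] by simp
qed

locale finite_symmetric_subset = group G for G :: "('g, 'm) monoid_scheme" (structure) +
  fixes S :: "'g set"
  assumes finite_S: "finite S" and S_subset: "S \<subseteq> carrier G" and inv_image_S: "(\<lambda>s. inv s) ` S = S"
begin

lemma bij_betw_inv_generators: "bij_betw (\<lambda>s. inv s) S S"
  using eq_card_imp_inj_on[OF finite_S, of "\<lambda>s. inv s"] inv_image_S by (simp add: bij_betw_def)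

lemma laplacian_op_sym:
  assumes \<pi>: "orthogonal_rep G \<pi>"
  shows "inner (laplacian_op S \<pi> x) y = inner x (laplacian_op S \<pi> y)"
proof -
  have "(\<Sum>s\<in>S. inner (\<pi> s x) y) = (\<Sum>s\<in>S. inner x (\<pi> (inv s) y))"
    using S_subset by (intro sum.cong refl orthogonal_rep_adjoint[OF is_group \<pi>]) auto
  also have "\<dots> = (\<Sum>s\<in>S. inner x (\<pi> s y))"
    by (rule sum.reindex_bij_betw[OF bij_betw_inv_generators])
  finally show ?thesis
    by (simp add: laplacian_op_apply inner_sum_left inner_sum_right inner_simps sum_subtractf)
qed

lemma norm_laplacian_op:
  "norm (laplacian_op S \<pi> x) = norm (\<Sum>s\<in>S. \<pi> s x - x)"
proof -
  have "laplacian_op S \<pi> x = - (\<Sum>s\<in>S. \<pi> s x - x)"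
    unfolding laplacian_op_apply sum_negf[symmetric] by simp
  then show ?thesis by simp
qed

lemma inner_laplacian_op:
  assumes \<pi>: "orthogonal_rep G \<pi>"
  shows "2 * inner (laplacian_op S \<pi> x) x = (\<Sum>s\<in>S. (norm (\<pi> s x - x))\<^sup>2)"
proof -
  have "(norm (\<pi> s x - x))\<^sup>2 = 2 * inner (x - \<pi> s x) x" if "s \<in> S" for s
    using that S_subset orthogonal_rep_isometric(2)[OF \<pi>, of s x x] unfolding power2_norm_eq_inner
    by (auto simp: inner_simps inner_commute)
  then show ?thesis by (simp add: laplacian_op_apply inner_sum_left sum_distrib_left)
qed

lemma norm_laplacian_op_le:
  assumes \<pi>: "orthogonal_rep G \<pi>"
  shows "norm (laplacian_op S \<pi> x) \<le> 2 * real (card S) * norm x"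
proof -
  have "norm (x - \<pi> s x) \<le> 2 * norm x" if "s \<in> S" for s
    using norm_triangle_ineq4[of x "\<pi> s x"] orthogonal_rep_isometric(1)[OF \<pi>, of s x] that S_subset by auto
  from sum_norm_le[OF this] show ?thesis by (simp add: laplacian_op_apply mult_ac)
qed

lemma spectral_parameter_minus_laplacian:
  "(complex_of_real t \<odot>\<^bsub>cstar_max G\<^esub> \<one>\<^bsub>cstar_max G\<^esub>) \<ominus>\<^bsub>cstar_max G\<^esub> laplacian_max G S
     = (\<lambda>U. if unitary_rep G U then t *\<^sub>R id_blinfun - laplacian_op S U else 0)" (is "?l = ?r")
proof -
  interpret R: ring "cstar_max G" by (rule ring_cstar_max[OF is_group])
  let ?\<Delta> = "laplacian_max G S"
  have \<Delta>: "?\<Delta> \<in> carrier (cstar_max G)" by (rule laplacian_max_closed[OF is_group finite_S S_subset])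
  have "(\<ominus>\<^bsub>cstar_max G\<^esub> ?\<Delta>) = (\<lambda>U. - ?\<Delta> U)"
  proof (rule R.minus_equality)
    show "(\<lambda>U. - ?\<Delta> U) \<in> carrier (cstar_max G)"
      using cstar_max_scaleR_closed[OF \<Delta>, of "-1"] by simp
  qed (use \<Delta> in \<open>simp_all add: cstar_max_def\<close>)
  moreover have "?\<Delta> U = (if unitary_rep G U then laplacian_op S U else 0)" for U
    unfolding laplacian_max_def universal_rep_def
    using extend_rep_laplacian[OF finite_S, of U G] by (auto simp: unitary_rep_def orthogonal_rep_def)
  ultimately show ?thesis
    by (simp add: a_minus_def) (simp add: cstar_max_def fun_eq_iff cscalar_of_real_compose)
qed

text \<open>The spectral gap as a Poincare-type inequality for coboundaries.  Both sides of the inequality are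
  expressed through the Laplacian by \<open>inner_laplacian_op\<close> and \<open>norm_laplacian_op\<close>.\<close>

theorem spectrum_avoids_iff:
  assumes \<eta>: "0 < \<eta>"
  shows "(\<forall>t\<in>{0<..<\<eta>}. complex_of_real t \<notin> spectrum (cstar_max G) (laplacian_max G S)) \<longleftrightarrow>
    (\<forall>U \<xi>. unitary_rep G U \<longrightarrow>
      \<eta> * (\<Sum>s\<in>S. (norm (U s \<xi> - \<xi>))\<^sup>2) \<le> 2 * (norm (\<Sum>s\<in>S. U s \<xi> - \<xi>))\<^sup>2)" (is "?gap \<longleftrightarrow> ?ineq")
proof -
  let ?B = "\<lambda>t U. if unitary_rep G U then t *\<^sub>R id_blinfun - laplacian_op S U else 0"
  have spec: "complex_of_real t \<notin> spectrum (cstar_max G) (laplacian_max G S)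
      \<longleftrightarrow> ?B t \<in> Units (cstar_max G)" for t
    by (simp add: spectrum_def spectral_parameter_minus_laplacian)
  have orth: "orthogonal_rep G U" if "unitary_rep G U" for U using that by (simp add: unitary_rep_def)
  have ineq: "?ineq \<longleftrightarrow> (\<forall>U \<xi>. unitary_rep G U \<longrightarrow>
      \<eta> * inner (laplacian_op S U \<xi>) \<xi> \<le> (norm (laplacian_op S U \<xi>))\<^sup>2)"
    by (auto simp: norm_laplacian_op inner_laplacian_op[OF orth, symmetric])
  show ?thesis
  proof
    assume gap: ?gap
    show ?ineq unfolding ineq
    proof (intro allI impI)
      fix U \<xi> assume U: "unitary_rep G U"
      show "\<eta> * inner (laplacian_op S U \<xi>) \<xi> \<le> (norm (laplacian_op S U \<xi>))\<^sup>2"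
      proof (rule spectral_inequality_of_left_inverses[OF laplacian_op_sym[OF orth[OF U]] \<eta>])
        fix t assume "0 < t" "t < \<eta>"
        then have "?B t \<in> Units (cstar_max G)" using gap spec by auto
        then obtain b where "b \<otimes>\<^bsub>cstar_max G\<^esub> ?B t = \<one>\<^bsub>cstar_max G\<^esub>" by (auto simp: Units_def)
        then have "b U o\<^sub>L (t *\<^sub>R id_blinfun - laplacian_op S U) = id_blinfun"
          using U by (auto simp: cstar_max_def dest: fun_cong[of _ _ U])
        then have "b U ((t *\<^sub>R id_blinfun - laplacian_op S U) x) = x" for x
          by (metis blinfun_apply_blinfun_compose blinfun_apply_id_blinfun id_apply)
        then show "\<exists>R. \<forall>x. blinfun_apply R (t *\<^sub>R x - laplacian_op S U x) = x"
          by (intro exI[of _ "b U"]) (simp add: blinfun.diff_left blinfun.scaleR_left)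
      qed
    qed
  next
    assume i: ?ineq
    show ?gap
    proof
      fix t assume "t \<in> {0<..<\<eta>}"
      then have t: "0 < t" "t < \<eta>" by auto
      have "?B t \<in> Units (cstar_max G)"
      proof (rule cstar_max_unit_if_bounded_below[OF is_group, where \<delta> = "min t (\<eta> - t)" and M = "t + 2 * real (card S)"])
        interpret R: ring "cstar_max G" by (rule ring_cstar_max[OF is_group])
        have "complex_of_real t \<odot>\<^bsub>cstar_max G\<^esub> \<one>\<^bsub>cstar_max G\<^esub> \<in> carrier (cstar_max G)"
          using cstar_max_smult_closed[OF cstar_max_one_closed[OF is_group]] by (simp add: cstar_max_def)
        then show "?B t \<in> carrier (cstar_max G)"
          unfolding spectral_parameter_minus_laplacian[symmetric]
          using laplacian_max_closed[OF is_group finite_S S_subset] by (rule R.minus_closed)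
        fix U x assume U: "unitary_rep G U"
        have B: "?B t U x = t *\<^sub>R x - laplacian_op S U x" for x
          using U by (simp add: blinfun.diff_left blinfun.scaleR_left)
        show "inner (?B t U x) y = inner x (?B t U y)" for y
          unfolding B by (simp add: inner_simps laplacian_op_sym[OF orth[OF U]])
        have "\<eta> * inner (laplacian_op S U x) x \<le> (norm (laplacian_op S U x))\<^sup>2" using i ineq U by blast
        from bounded_below_of_spectral_inequality[OF t this]
        have "(min t (\<eta> - t) * norm x)\<^sup>2 \<le> (norm (t *\<^sub>R x - laplacian_op S U x))\<^sup>2"
          by (simp add: power_mult_distrib)
        then show "min t (\<eta> - t) * norm x \<le> norm (?B t U x)"
          unfolding B by (rule power2_le_imp_le) simp
        show "norm (?B t U x) \<le> (t + 2 * real (card S)) * norm x"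
          unfolding B using norm_triangle_ineq4[of "t *\<^sub>R x" "laplacian_op S U x"] t
            norm_laplacian_op_le[OF orth[OF U], of x] by (simp add: distrib_right)
      qed (use t in auto)
      then show "complex_of_real t \<notin> spectrum (cstar_max G) (laplacian_max G S)" using spec by blast
    qed
  qed
qed

end

section \<open>Cocycles of finitely generated groups\<close>

lemma cocycle_coboundary:
  assumes "orthogonal_rep G \<pi>"
  shows "cocycle G \<pi> (\<lambda>g. \<pi> g \<xi> - \<xi>)"
  using assms by (auto simp: cocycle_def orthogonal_rep_def blinfun.diff_right)

lemma cocycle_scaleR: "cocycle G \<pi> c \<Longrightarrow> cocycle G \<pi> (\<lambda>g. r *\<^sub>R c g)"
  by (auto simp: cocycle_def blinfun.scaleR_right scaleR_add_right)

lemma cocycle_diff_translate: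
  assumes "cocycle G \<pi> c" "k \<in> carrier G" "g \<in> carrier G" "h \<in> carrier G"
  shows "c (k \<otimes>\<^bsub>G\<^esub> g) - c (k \<otimes>\<^bsub>G\<^esub> h) = \<pi> k (c g - c h)"
  using assms by (simp add: cocycle_def blinfun.diff_right)

lemma symmetric_generators_word:
  fixes G :: "('g, 'm) monoid_scheme" (structure)
  assumes G: "group G" and S: "S \<subseteq> carrier G" "(\<lambda>s. inv s) ` S = S"
    and g: "g \<in> generate G S"
  shows "\<exists>xs\<in>lists S. g = foldr (\<otimes>) xs \<one>"
  using g
proof (induction rule: generate.induct)
  interpret group G by (rule G)
  {
    case one
    show ?case by (intro bexI[of _ "[]"]) auto
  next
    case (incl h)
    then show ?case using S by (intro bexI[of _ "[h]"]) auto
  next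
    case (inv h)
    then have "inv h \<in> S" using S(2) by blast
    then show ?case using S(1) by (intro bexI[of _ "[inv h]"]) auto
  next
    case (eng h1 h2)
    then obtain xs ys where xs: "xs \<in> lists S" "h1 = foldr (\<otimes>) xs \<one>"
      and ys: "ys \<in> lists S" "h2 = foldr (\<otimes>) ys \<one>" by blast
    have closed: "foldr (\<otimes>) zs \<one> \<in> carrier G" if "zs \<in> lists S" for zs
      using that by (induction zs) (use S(1) in auto)
    have "foldr (\<otimes>) (xs @ ys) \<one> = foldr (\<otimes>) xs \<one> \<otimes> h2"
      using xs(1) unfolding ys(2)
    proof (induction xs)
      case Nil
      then show ?case using closed[OF ys(1)] by simp
    next
      case (Cons x xs)
      then have "x \<in> carrier G" "foldr (\<otimes>) xs \<one> \<in> carrier G" "foldr (\<otimes>) ys \<one> \<in> carrier G"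
        using S(1) closed ys(1) by auto
      then show ?case using Cons by (simp add: m_assoc)
    qed
    then show ?case using xs ys by (intro bexI[of _ "xs @ ys"]) auto
  }
qed

locale finite_symmetric_generating_set = finite_symmetric_subset G S
  for G :: "('g, 'm) monoid_scheme" (structure) and S +
  assumes generate_S: "generate G S = carrier G"
begin

lemma countable_carrier: "countable (carrier G)"
proof -
  have "carrier G \<subseteq> (\<lambda>xs. foldr (\<otimes>) xs \<one>) ` lists S"
    using symmetric_generators_word[OF is_group S_subset inv_image_S] generate_S by auto
  moreover have "countable (lists S)" using finite_S by (intro countable_lists countable_finite)
  ultimately show ?thesis using countable_subset countable_image by metis
qed

lemma carrier_enumeration:
  obtains e :: "nat \<Rightarrow> 'g" where "range e = carrier G"
proof -
  have "carrier G \<noteq> {}" using one_closed by blast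
  then show ?thesis by (rule that[OF range_from_nat_into[OF _ countable_carrier]])
qed

text \<open>On generators the normalisation gives the bound \<open>sqrt 2\<close>, and by the cocycle identity bounds add under products.
  The bound is independent of the representation, as required for compactness.\<close>

lemma cocycle_uniform_bound:
  assumes g: "g \<in> carrier G"
  shows "\<exists>B\<ge>0. \<forall>\<pi> c. orthogonal_rep G \<pi> \<longrightarrow> cocycle G \<pi> c \<longrightarrow> (\<Sum>s\<in>S. (norm (c s))\<^sup>2) = 2 \<longrightarrow>
    norm (c g :: 'h::{real_inner, complete_space}) \<le> B"
proof -
  let ?bounded = "\<lambda>g. \<exists>B\<ge>0. \<forall>\<pi> c. orthogonal_rep G \<pi> \<longrightarrow> cocycle G \<pi> c \<longrightarrow>
    (\<Sum>s\<in>S. (norm (c s))\<^sup>2) = 2 \<longrightarrow> norm (c g :: 'h) \<le> B"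
  have gen_bound: "?bounded s" if s: "s \<in> S" for s
  proof (intro exI[of _ "sqrt 2"] conjI allI impI)
    fix \<pi> and c :: "'g \<Rightarrow> 'h"
    assume "(\<Sum>s\<in>S. (norm (c s))\<^sup>2) = 2"
    moreover have "(norm (c s))\<^sup>2 \<le> (\<Sum>s\<in>S. (norm (c s))\<^sup>2)"
      by (rule member_le_sum) (use s finite_S in auto)
    ultimately have "sqrt ((norm (c s))\<^sup>2) \<le> sqrt 2" by (intro real_sqrt_le_mono) simp
    then show "norm (c s) \<le> sqrt 2" by simp
  qed simp
  have "g \<in> generate G S" using g generate_S by simp
  then show "?bounded g"
  proof (induction rule: generate.induct)
    case one
    then show ?case by (intro exI[of _ 0]) (simp add: cocycle_def)
  next
    case (incl h)
    then show ?case by (rule gen_bound)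
  next
    case (inv h)
    then have "inv h \<in> S" using inv_image_S by blast
    then show ?case by (rule gen_bound)
  next
    case (eng g h)
    then have gh: "g \<in> carrier G" "h \<in> carrier G" using generate_S by auto
    obtain B1 where B1: "B1 \<ge> 0" "\<forall>\<pi> c. orthogonal_rep G \<pi> \<longrightarrow> cocycle G \<pi> c \<longrightarrow>
        (\<Sum>s\<in>S. (norm (c s))\<^sup>2) = 2 \<longrightarrow> norm (c g :: 'h) \<le> B1" using eng.IH(1) by blast
    obtain B2 where B2: "B2 \<ge> 0" "\<forall>\<pi> c. orthogonal_rep G \<pi> \<longrightarrow> cocycle G \<pi> c \<longrightarrow>
        (\<Sum>s\<in>S. (norm (c s))\<^sup>2) = 2 \<longrightarrow> norm (c h :: 'h) \<le> B2" using eng.IH(2) by blast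
    show ?case
    proof (intro exI[of _ "B1 + B2"] conjI allI impI)
      fix \<pi> and c :: "'g \<Rightarrow> 'h"
      assume \<pi>: "orthogonal_rep G \<pi>" and c: "cocycle G \<pi> c" "(\<Sum>s\<in>S. (norm (c s))\<^sup>2) = 2"
      have "norm (c (g \<otimes> h)) \<le> norm (c g) + norm (\<pi> g (c h))"
        using c(1) gh by (simp add: cocycle_def norm_triangle_ineq)
      also have "\<dots> \<le> B1 + B2"
        using B1(2) B2(2) \<pi> c by (intro add_mono) (auto simp: orthogonal_rep_isometric(1)[OF \<pi> gh(1)])
      finally show "norm (c (g \<otimes> h)) \<le> B1 + B2" .
    qed (use B1(1) B2(1) in simp)
  qed
qed

section \<open>The spectral inequality passes from coboundaries to cocycles\<close>

lemma one_minus_exp_quotient_limit: "((\<lambda>t. (1 - exp (- t * a)) / t) \<longlongrightarrow> a) (at_right (0::real))"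
proof -
  have "((\<lambda>t. exp (- t * a)) has_real_derivative - a) (at 0)"
    by (auto intro!: derivative_eq_intros)
  then have "((\<lambda>t. (exp (- t * a) - 1) / t) \<longlongrightarrow> - a) (at 0)"
    by (simp add: DERIV_def)
  then have "((\<lambda>t. - ((exp (- t * a) - 1) / t)) \<longlongrightarrow> - (- a)) (at_right 0)"
    by (intro tendsto_minus) (rule tendsto_mono[OF at_le], auto)
  then show ?thesis by (simp add: minus_divide_left)
qed

text \<open>The positive semidefinite kernels \<open>K t\<close> approximate \<open>c\<close> by coboundaries: the coboundary of the cyclic
  vector of \<open>K t\<close> has Gram matrix \<open>D t\<close>, and \<open>D t / t\<close> tends to twice the Gram matrix of \<open>c\<close>.\<close>

theorem cocycle_inequality:
  fixes c :: "'g \<Rightarrow> 'h::{real_inner, complete_space}"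
  assumes ineq: "\<And>U \<xi>. unitary_rep G U \<Longrightarrow>
      \<eta> * (\<Sum>s\<in>S. (norm (U s \<xi> - \<xi>))\<^sup>2) \<le> 2 * (norm (\<Sum>s\<in>S. U s \<xi> - \<xi>))\<^sup>2"
    and \<pi>: "orthogonal_rep G \<pi>" and c: "cocycle G \<pi> c"
  shows "\<eta> * (\<Sum>s\<in>S. (norm (c s))\<^sup>2) \<le> 2 * (norm (\<Sum>s\<in>S. c s))\<^sup>2"
proof -
  obtain e :: "nat \<Rightarrow> 'g" where e: "range e = carrier G" by (rule carrier_enumeration)
  have c1: "c \<one> = 0" using c by (simp add: cocycle_def)
  define K where "K t g h = exp (- t * (norm (c g - c h))\<^sup>2)" for t g h
  define D where "D t s s' = K t s s' - K t s \<one> - K t \<one> s' + 1" for t s s'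
  have D_ineq: "\<eta> * (\<Sum>s\<in>S. D t s s) \<le> 2 * (\<Sum>s\<in>S. \<Sum>s'\<in>S. D t s s')" if t: "t > 0" for t
  proof -
    have psdK: "psd (\<lambda>m n. K t (e m) (e n))"
      unfolding K_def using t by (intro psd_gaussian) simp
    have K_inv: "K t (k \<otimes> g) (k \<otimes> h) = K t g h"
      if "k \<in> carrier G" "g \<in> carrier G" "h \<in> carrier G" for k g h
      unfolding K_def cocycle_diff_translate[OF c that] orthogonal_rep_isometric(1)[OF \<pi> that(1)] ..
    obtain \<rho> and w :: "'g \<Rightarrow> real ell2" where \<rho>: "orthogonal_rep G \<rho>"
      and w: "\<And>g h. g \<in> carrier G \<Longrightarrow> h \<in> carrier G \<Longrightarrow> inner (w g) (w h) = K t g h"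
        "\<And>g h. g \<in> carrier G \<Longrightarrow> h \<in> carrier G \<Longrightarrow> blinfun_apply (\<rho> g) (w h) = w (g \<otimes> h)"
      by (rule gns_construction[where act = "(\<otimes>)" and K = "K t",
            OF is_group e[symmetric] psdK m_closed l_one m_assoc K_inv]; (assumption | rule that))
    define U where "U g = complexify (\<rho> g)" for g
    define \<xi> where "\<xi> = complex_pair (w \<one>) 0"
    have U: "unitary_rep G U" unfolding U_def by (rule complexification[OF \<rho>])
    have "U s \<xi> - \<xi> = complex_pair (w s - w \<one>) 0" if "s \<in> S" for s
    proof -
      have "s \<in> carrier G" using that S_subset by blast
      then show ?thesis
        using complex_pair_add[of "w s - w \<one>" "w \<one>" 0 0]
        by (simp add: U_def \<xi>_def complexify_apply parts_complex_pair w(2))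
    qed
    moreover have "inner (complex_pair (w s - w \<one>) 0) (complex_pair (w s' - w \<one>) 0) = D t s s'"
      if "s \<in> S" "s' \<in> S" for s s'
    proof -
      have "s \<in> carrier G" "s' \<in> carrier G" "K t \<one> \<one> = 1" using that S_subset by (auto simp: K_def)
      then show ?thesis by (simp add: inner_complex_pair inner_diff_left inner_diff_right w(1) D_def)
    qed
    ultimately have gram: "inner (U s \<xi> - \<xi>) (U s' \<xi> - \<xi>) = D t s s'" if "s \<in> S" "s' \<in> S" for s s'
      using that by simp
    show ?thesis
      using ineq[OF U, of \<xi>] unfolding power2_norm_eq_inner inner_sum_left inner_sum_right
      by (simp add: gram sum.swap[of "\<lambda>x y. D t y x"])
  qed
  have D_lim: "((\<lambda>t. D t s s' / t) \<longlongrightarrow> 2 * inner (c s) (c s')) (at_right 0)" for s s'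
  proof -
    have "D t s s' / t = (1 - exp (- t * (norm (c s))\<^sup>2)) / t + (1 - exp (- t * (norm (c s'))\<^sup>2)) / t
        - (1 - exp (- t * (norm (c s - c s'))\<^sup>2)) / t" for t
      by (simp add: D_def K_def c1 add_divide_distrib diff_divide_distrib)
    moreover have "2 * inner (c s) (c s')
        = (norm (c s))\<^sup>2 + (norm (c s'))\<^sup>2 - (norm (c s - c s'))\<^sup>2"
      unfolding power2_norm_eq_inner by (simp add: inner_simps inner_commute)
    ultimately show ?thesis
      by (simp only:) (intro tendsto_intros one_minus_exp_quotient_limit)
  qed
  have "\<eta> * (\<Sum>s\<in>S. 2 * inner (c s) (c s)) \<le> 2 * (\<Sum>s\<in>S. \<Sum>s'\<in>S. 2 * inner (c s) (c s'))"
  proof (rule tendsto_le)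
    show "((\<lambda>t. \<eta> * (\<Sum>s\<in>S. D t s s / t)) \<longlongrightarrow> \<eta> * (\<Sum>s\<in>S. 2 * inner (c s) (c s))) (at_right 0)"
      by (intro tendsto_intros D_lim)
    show "((\<lambda>t. 2 * (\<Sum>s\<in>S. \<Sum>s'\<in>S. D t s s' / t))
        \<longlongrightarrow> 2 * (\<Sum>s\<in>S. \<Sum>s'\<in>S. 2 * inner (c s) (c s'))) (at_right 0)"
      by (intro tendsto_intros D_lim)
    have "\<eta> * (\<Sum>s\<in>S. D t s s / t) \<le> 2 * (\<Sum>s\<in>S. \<Sum>s'\<in>S. D t s s' / t)" if "t > 0" for t
      unfolding sum_divide_distrib[symmetric]
      using divide_right_mono[OF D_ineq[OF that], of t] that by simp
    then show "\<forall>\<^sub>F t in at_right 0. \<eta> * (\<Sum>s\<in>S. D t s s / t) \<le> 2 * (\<Sum>s\<in>S. \<Sum>s'\<in>S. D t s s' / t)"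
      using eventually_at_right_less by (rule eventually_mono[rotated])
  qed simp
  moreover have "(\<Sum>s\<in>S. \<Sum>s'\<in>S. inner (c s) (c s')) = (norm (\<Sum>s\<in>S. c s))\<^sup>2"
    unfolding power2_norm_eq_inner inner_sum_left inner_sum_right by (rule sum.swap)
  ultimately show ?thesis
    by (simp add: sum_distrib_left[symmetric] power2_norm_eq_inner[of "c _"])
qed

section \<open>Limits of cocycles\<close>

text \<open>A cocycle gives an invariant kernel on pairs, the Gram matrix of the differences \<open>c g - c h\<close>, on which the
  group acts diagonally.  Invariance, semidefiniteness and the relation
  \<open>(c g - c h) + (c h - c l) = c g - c l\<close> are expressed by inner products and hence survive the
  limit; the relation is recovered because the square of the norm of its defect is an expression
  in the kernel.\<close>

theorem limit_cocycle:
  fixes c :: "nat \<Rightarrow> 'g \<Rightarrow> 'h::{real_inner, complete_space}"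
  assumes \<pi>: "\<And>n. orthogonal_rep G (\<pi> n)" and c: "\<And>n. cocycle G (\<pi> n) (c n)"
    and lim: "\<And>g h. g \<in> carrier G \<Longrightarrow> h \<in> carrier G \<Longrightarrow> (\<lambda>n. inner (c n g) (c n h)) \<longlonglongrightarrow> k g h"
  shows "\<exists>\<rho> c'. orthogonal_rep G \<rho> \<and> cocycle G \<rho> (c' :: 'g \<Rightarrow> real ell2) \<and>
    (\<forall>g\<in>carrier G. \<forall>h\<in>carrier G. inner (c' g) (c' h) = k g h)"
proof -
  obtain e :: "nat \<Rightarrow> 'g" where e: "range e = carrier G" by (rule carrier_enumeration)
  have e_mem: "e n \<in> carrier G" for n using e by blast
  define d where "d n p = c n (fst p) - c n (snd p)" for n p
  define K where "K p q = k (fst p) (fst q) - k (fst p) (snd q) - k (snd p) (fst q) + k (snd p) (snd q)"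
    for p q
  define I where "I = carrier G \<times> carrier G"
  have K_lim: "(\<lambda>n. inner (d n p) (d n q)) \<longlonglongrightarrow> K p q" if "p \<in> I" "q \<in> I" for p q
  proof -
    have "fst p \<in> carrier G" "snd p \<in> carrier G" "fst q \<in> carrier G" "snd q \<in> carrier G"
      using that by (auto simp: I_def)
    then have "(\<lambda>n. inner (c n (fst p)) (c n (fst q)) - inner (c n (fst p)) (c n (snd q))
        - inner (c n (snd p)) (c n (fst q)) + inner (c n (snd p)) (c n (snd q))) \<longlonglongrightarrow> K p q"
      unfolding K_def by (intro tendsto_intros lim)
    then show ?thesis by (simp add: d_def inner_diff_left inner_diff_right algebra_simps)
  qed
  define e2 where "e2 m = map_prod e e (prod_decode m)" for m
  have I: "I = range e2"
  proof
    show "I \<subseteq> range e2"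
    proof
      fix p assume "p \<in> I"
      then obtain m n where "p = (e m, e n)" unfolding I_def e[symmetric] by blast
      then have "p = e2 (prod_encode (m, n))" by (simp add: e2_def)
      then show "p \<in> range e2" by blast
    qed
    show "range e2 \<subseteq> I" using e_mem by (auto simp: e2_def I_def map_prod_def split: prod.splits)
  qed
  have e2: "e2 m \<in> I" for m by (simp add: I)
  have psdK: "psd (\<lambda>m n. K (e2 m) (e2 n))"
    by (rule psd_limit[of "\<lambda>N m n. inner (d N (e2 m)) (d N (e2 n))"]) (intro psd_gram K_lim e2)+
  define act where "act g = map_prod ((\<otimes>) g) ((\<otimes>) g)" for g
  have act_I: "act g p \<in> I" if "g \<in> carrier G" "p \<in> I" for g p
    using that by (auto simp: act_def I_def)
  have act_one: "act \<one> p = p" if "p \<in> I" for p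
    using that by (auto simp: act_def I_def)
  have act_mult: "act (g \<otimes> h) p = act g (act h p)"
    if "g \<in> carrier G" "h \<in> carrier G" "p \<in> I" for g h p
    using that by (auto simp: act_def I_def m_assoc)
  have K_inv: "K (act g p) (act g q) = K p q" if "g \<in> carrier G" "p \<in> I" "q \<in> I" for g p q
  proof -
    have "d n (act g p) = \<pi> n g (d n p)" if "p \<in> I" for n p
      using that cocycle_diff_translate[OF c \<open>g \<in> carrier G\<close>] by (auto simp: d_def act_def I_def)
    then have "(\<lambda>n. inner (d n (act g p)) (d n (act g q))) = (\<lambda>n. inner (d n p) (d n q))"
      using that orthogonal_rep_isometric(2)[OF \<pi> that(1)] by simp
    then show ?thesis
      using K_lim[OF act_I[OF that(1,2)] act_I[OF that(1,3)]] K_lim[OF that(2,3)] LIMSEQ_unique by auto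
  qed
  obtain \<rho> and w :: "'g \<times> 'g \<Rightarrow> real ell2" where \<rho>: "orthogonal_rep G \<rho>"
    and w: "\<And>p q. p \<in> I \<Longrightarrow> q \<in> I \<Longrightarrow> inner (w p) (w q) = K p q"
      "\<And>g p. g \<in> carrier G \<Longrightarrow> p \<in> I \<Longrightarrow> blinfun_apply (\<rho> g) (w p) = w (act g p)"
    by (rule gns_construction[where act = act and K = K,
          OF is_group I psdK act_I act_one act_mult K_inv]; (assumption | rule that))
  have chain: "w (g, h) + w (h, l) = w (g, l)" if "g \<in> carrier G" "h \<in> carrier G" "l \<in> carrier G" for g h l
  proof -
    have "inner (w (g, h) + w (h, l) - w (g, l)) (w (g, h) + w (h, l) - w (g, l)) = 0"
      using that by (simp add: inner_add_left inner_add_right inner_diff_left inner_diff_right w(1) I_def K_def)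
    then show ?thesis by simp
  qed
  define c' where "c' g = w (g, \<one>)" for g
  have "cocycle G \<rho> c'"
    unfolding cocycle_def
  proof (intro conjI ballI)
    show "c' \<one> = 0" using chain[of \<one> \<one> \<one>] by (simp add: c'_def)
    fix g h assume gh: "g \<in> carrier G" "h \<in> carrier G"
    have "\<rho> g (c' h) = w (g \<otimes> h, g)" using gh w(2)[of g "(h, \<one>)"] by (simp add: c'_def act_def I_def)
    then show "c' (g \<otimes> h) = c' g + \<rho> g (c' h)"
      using chain[of "g \<otimes> h" g \<one>] gh by (simp add: c'_def add.commute)
  qed
  moreover have "inner (c' g) (c' h) = k g h" if "g \<in> carrier G" "h \<in> carrier G" for g h
  proof (rule LIMSEQ_unique[OF _ lim[OF that]])
    have "(\<lambda>n. inner (d n (g, \<one>)) (d n (h, \<one>))) \<longlonglongrightarrow> inner (c' g) (c' h)"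
      using K_lim[of "(g, \<one>)" "(h, \<one>)"] that w(1)[of "(g, \<one>)" "(h, \<one>)"] by (simp add: c'_def I_def)
    moreover have "c n \<one> = 0" for n using c[of n] by (simp add: cocycle_def)
    ultimately show "(\<lambda>n. inner (c n g) (c n h)) \<longlonglongrightarrow> inner (c' g) (c' h)" by (simp add: d_def)
  qed
  ultimately show ?thesis using \<rho> by blast
qed

lemma convergent_subsequence_of_cocycles:
  fixes c :: "nat \<Rightarrow> 'g \<Rightarrow> 'h::{real_inner, complete_space}"
  assumes \<pi>: "\<And>n. orthogonal_rep G (\<pi> n)" and c: "\<And>n. cocycle G (\<pi> n) (c n)"
    and norm: "\<And>n. (\<Sum>s\<in>S. (norm (c n s))\<^sup>2) = 2"
  shows "\<exists>r k. strict_mono (r :: nat \<Rightarrow> nat) \<and> (\<forall>g\<in>carrier G. \<forall>h\<in>carrier G.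
    (\<lambda>n. inner (c (r n) g) (c (r n) h)) \<longlonglongrightarrow> k g h)"
proof -
  have "\<forall>g\<in>carrier G. \<exists>B\<ge>0. \<forall>n. norm (c n g) \<le> B"
  proof
    fix g assume "g \<in> carrier G"
    from cocycle_uniform_bound[OF this, where 'h = 'h] \<pi> c norm
    show "\<exists>B\<ge>0. \<forall>n. norm (c n g) \<le> B" by metis
  qed
  then obtain B where B: "\<And>g. g \<in> carrier G \<Longrightarrow> 0 \<le> B g" "\<And>g n. g \<in> carrier G \<Longrightarrow> norm (c n g) \<le> B g"
    by metis
  \<comment> \<open>A positive bound, by which the inner products can be divided to obtain a common bound.\<close>
  define b where "b g = B g + 1" for g
  have b: "0 < b g" "norm (c n g) \<le> b g" if "g \<in> carrier G" for g n
    using B[OF that] by (auto simp: b_def intro: add_increasing2 order.trans add_nonneg_pos)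
  define f where "f n p = inner (c n (fst p)) (c n (snd p)) / (b (fst p) * b (snd p))" for n p
  have "norm (f n p) \<le> 1" if "p \<in> carrier G \<times> carrier G" for n p
  proof -
    have p: "fst p \<in> carrier G" "snd p \<in> carrier G" using that by auto
    have "\<bar>inner (c n (fst p)) (c n (snd p))\<bar> \<le> norm (c n (fst p)) * norm (c n (snd p))"
      by (rule Cauchy_Schwarz_ineq2)
    also have "\<dots> \<le> b (fst p) * b (snd p)"
      using b[OF p(1)] b[OF p(2)] by (intro mult_mono) (auto intro: less_imp_le)
    finally show ?thesis
      using b(1)[OF p(1)] b(1)[OF p(2)] by (simp add: f_def abs_mult divide_le_eq)
  qed
  moreover have "countable (carrier G \<times> carrier G)" by (intro countable_SIGMA countable_carrier)
  ultimately obtain r :: "nat \<Rightarrow> nat" where r: "strict_mono r"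
    and conv: "\<And>p. p \<in> carrier G \<times> carrier G \<Longrightarrow> \<exists>l. (\<lambda>n. f (r n) p) \<longlonglongrightarrow> l"
    using function_convergent_subsequence[of "carrier G \<times> carrier G" f 1] by metis
  have "\<exists>l. (\<lambda>n. inner (c (r n) g) (c (r n) h)) \<longlonglongrightarrow> l" if gh: "g \<in> carrier G" "h \<in> carrier G" for g h
  proof -
    obtain l where "(\<lambda>n. f (r n) (g, h)) \<longlonglongrightarrow> l" using conv[of "(g, h)"] gh by auto
    then have "(\<lambda>n. f (r n) (g, h) * (b g * b h)) \<longlonglongrightarrow> l * (b g * b h)" by (intro tendsto_intros)
    moreover have "f (r n) (g, h) * (b g * b h) = inner (c (r n) g) (c (r n) h)" for n
      using b(1)[OF gh(1)] b(1)[OF gh(2)] by (simp add: f_def)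
    ultimately show ?thesis by auto
  qed
  then have "\<forall>g h. \<exists>l. g \<in> carrier G \<longrightarrow> h \<in> carrier G \<longrightarrow> (\<lambda>n. inner (c (r n) g) (c (r n) h)) \<longlonglongrightarrow> l"
    by blast
  then obtain k where "\<And>g h. g \<in> carrier G \<Longrightarrow> h \<in> carrier G \<Longrightarrow>
      (\<lambda>n. inner (c (r n) g) (c (r n) h)) \<longlonglongrightarrow> k g h" by metis
  with r show ?thesis by blast
qed

section \<open>The spectral gap as a minimum over cocycles\<close>

lemma normalized_coboundary:
  fixes \<xi> :: "'h::{real_inner, complete_space}"
  assumes \<pi>: "orthogonal_rep G \<pi>" and pos: "0 < (\<Sum>s\<in>S. (norm (\<pi> s \<xi> - \<xi>))\<^sup>2)"
  shows "\<exists>c\<in>(normalized_cocycles G S :: ('g \<Rightarrow> 'h) set). (norm (\<Sum>s\<in>S. c s))\<^sup>2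
    = 2 * (norm (\<Sum>s\<in>S. \<pi> s \<xi> - \<xi>))\<^sup>2 / (\<Sum>s\<in>S. (norm (\<pi> s \<xi> - \<xi>))\<^sup>2)"
proof -
  define N where "N = (\<Sum>s\<in>S. (norm (\<pi> s \<xi> - \<xi>))\<^sup>2)"
  define r where "r = sqrt (2 / N)"
  have N: "N > 0" using pos by (simp add: N_def)
  then have r: "r\<^sup>2 = 2 / N" by (simp add: r_def)
  define c where "c g = r *\<^sub>R (\<pi> g \<xi> - \<xi>)" for g
  have "(\<Sum>s\<in>S. (norm (c s))\<^sup>2) = r\<^sup>2 * N"
    by (simp add: c_def N_def power_mult_distrib sum_distrib_left)
  then have "(\<Sum>s\<in>S. (norm (c s))\<^sup>2) = 2" using N r by simp
  moreover have "cocycle G \<pi> c"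
    unfolding c_def by (intro cocycle_scaleR cocycle_coboundary \<pi>)
  ultimately have "c \<in> normalized_cocycles G S" using \<pi> by (auto simp: normalized_cocycles_def)
  moreover have "(norm (\<Sum>s\<in>S. c s))\<^sup>2 = r\<^sup>2 * (norm (\<Sum>s\<in>S. \<pi> s \<xi> - \<xi>))\<^sup>2"
    unfolding c_def scaleR_sum_right[symmetric] by (simp add: power_mult_distrib)
  ultimately show ?thesis using r by (intro bexI[of _ c]) (simp_all add: N_def)
qed

lemma spectral_gap_nonneg: "0 \<le> spectral_gap G S"
  unfolding spectral_gap_def zero_ereal_def by (intro Sup_upper) auto

lemma spectral_gap_le:
  assumes c: "c \<in> (normalized_cocycles G S :: ('g \<Rightarrow> 'h::{real_inner, complete_space}) set)"
  shows "spectral_gap G S \<le> ereal ((norm (\<Sum>s\<in>S. c s))\<^sup>2)"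
  unfolding spectral_gap_def
proof (rule Sup_least, clarify)
  fix e :: real
  assume e: "0 \<le> e" "\<forall>x\<in>{0<..<e}. complex_of_real x \<notin> spectrum (cstar_max G) (laplacian_max G S)"
  obtain \<pi> where \<pi>: "orthogonal_rep G \<pi>" "cocycle G \<pi> c" and norm: "(\<Sum>s\<in>S. (norm (c s))\<^sup>2) = 2"
    using c by (auto simp: normalized_cocycles_def)
  have "e \<le> (norm (\<Sum>s\<in>S. c s))\<^sup>2"
  proof (cases "e = 0")
    case False
    then have "0 < e" using e(1) by simp
    then have "\<And>U \<xi>. unitary_rep G U \<Longrightarrow>
      e * (\<Sum>s\<in>S. (norm (U s \<xi> - \<xi>))\<^sup>2) \<le> 2 * (norm (\<Sum>s\<in>S. U s \<xi> - \<xi>))\<^sup>2"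
      using spectrum_avoids_iff e(2) by blast
    from cocycle_inequality[OF this \<pi>] show ?thesis unfolding norm by simp
  qed simp
  then show "ereal e \<le> ereal ((norm (\<Sum>s\<in>S. c s))\<^sup>2)" by simp
qed

text \<open>If \<open>\<eta>\<close> exceeds the gap, the inequality of \<open>spectrum_avoids_iff\<close> fails for some vector, and its
  coboundary only needs to be rescaled.\<close>

lemma normalized_cocycle_below:
  assumes \<eta>: "spectral_gap G S < ereal \<eta>"
  shows "\<exists>c\<in>(normalized_cocycles G S :: ('g \<Rightarrow> complex ell2) set). (norm (\<Sum>s\<in>S. c s))\<^sup>2 < \<eta>"
proof -
  have "ereal 0 < ereal \<eta>" using spectral_gap_nonneg \<eta> unfolding zero_ereal_def by (rule order.strict_trans1)
  then have \<eta>0: "0 < \<eta>" by simp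
  have "\<not> (\<forall>t\<in>{0<..<\<eta>}. complex_of_real t \<notin> spectrum (cstar_max G) (laplacian_max G S))"
  proof
    assume "\<forall>t\<in>{0<..<\<eta>}. complex_of_real t \<notin> spectrum (cstar_max G) (laplacian_max G S)"
    then have "ereal \<eta> \<le> spectral_gap G S"
      unfolding spectral_gap_def using \<eta>0 by (intro Sup_upper) auto
    with \<eta> show False by simp
  qed
  then obtain U \<xi> where U: "unitary_rep G U"
    and lt: "2 * (norm (\<Sum>s\<in>S. U s \<xi> - \<xi>))\<^sup>2 < \<eta> * (\<Sum>s\<in>S. (norm (U s \<xi> - \<xi>))\<^sup>2)"
    unfolding spectrum_avoids_iff[OF \<eta>0] by (auto simp: not_le)
  let ?N = "\<Sum>s\<in>S. (norm (U s \<xi> - \<xi>))\<^sup>2"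
  have "0 < \<eta> * ?N" by (rule order.strict_trans1[OF _ lt]) simp
  then have N: "0 < ?N" using \<eta>0 by (simp add: zero_less_mult_iff)
  have "2 * (norm (\<Sum>s\<in>S. U s \<xi> - \<xi>))\<^sup>2 / ?N < \<eta>"
    using lt N by (simp add: pos_divide_less_eq)
  moreover have "orthogonal_rep G U" using U by (simp add: unitary_rep_def)
  ultimately show ?thesis using normalized_coboundary[OF _ N] by metis
qed

text \<open>Normalised coboundaries with values tending to the gap have a limit cocycle.  The normalisation and
  the value involve finitely many inner products, so both pass to the limit.  Finiteness of the
  gap guarantees that there are normalised cocycles at all; for the trivial group there are none.\<close>

theorem spectral_gap_attained:
  assumes fin: "spectral_gap G S < \<infinity>"
  shows "\<exists>c\<in>(normalized_cocycles G S :: ('g \<Rightarrow> real ell2) set).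
    ereal ((norm (\<Sum>s\<in>S. c s))\<^sup>2) = spectral_gap G S"
proof -
  obtain l where l: "spectral_gap G S = ereal l"
    using fin spectral_gap_nonneg by (cases "spectral_gap G S") auto
  have "\<exists>c\<in>(normalized_cocycles G S :: ('g \<Rightarrow> complex ell2) set).
      (norm (\<Sum>s\<in>S. c s))\<^sup>2 < l + 1 / real (Suc n)" for n
    by (rule normalized_cocycle_below) (simp add: l)
  then obtain c :: "nat \<Rightarrow> 'g \<Rightarrow> complex ell2" where c: "\<And>n. c n \<in> normalized_cocycles G S"
    and c_lt: "\<And>n. (norm (\<Sum>s\<in>S. c n s))\<^sup>2 < l + 1 / real (Suc n)"
    by metis
  then have "\<forall>n. \<exists>\<pi>. orthogonal_rep G \<pi> \<and> cocycle G \<pi> (c n)" by (auto simp: normalized_cocycles_def)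
  then obtain \<pi> where \<pi>: "\<And>n. orthogonal_rep G (\<pi> n)" "\<And>n. cocycle G (\<pi> n) (c n)" by metis
  have c2: "(\<Sum>s\<in>S. (norm (c n s))\<^sup>2) = 2" for n using c[of n] by (simp add: normalized_cocycles_def)
  obtain r :: "nat \<Rightarrow> nat" and k where r: "strict_mono r"
    and k: "\<And>g h. g \<in> carrier G \<Longrightarrow> h \<in> carrier G \<Longrightarrow> (\<lambda>n. inner (c (r n) g) (c (r n) h)) \<longlonglongrightarrow> k g h"
    using convergent_subsequence_of_cocycles[of \<pi> c, OF \<pi> c2] by blast
  obtain \<rho> and c' :: "'g \<Rightarrow> real ell2" where \<rho>: "orthogonal_rep G \<rho>" "cocycle G \<rho> c'"
    and gram: "\<And>g h. g \<in> carrier G \<Longrightarrow> h \<in> carrier G \<Longrightarrow> inner (c' g) (c' h) = k g h"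
    using limit_cocycle[of "\<lambda>n. \<pi> (r n)" "\<lambda>n. c (r n)" k, OF \<pi> k] by blast
  have lim: "(\<lambda>n. inner (c (r n) s) (c (r n) s')) \<longlonglongrightarrow> inner (c' s) (c' s')" if "s \<in> S" "s' \<in> S" for s s'
  proof -
    have "s \<in> carrier G" "s' \<in> carrier G" using that S_subset by auto
    then show ?thesis using k gram by simp
  qed
  have "(\<lambda>n. \<Sum>s\<in>S. inner (c (r n) s) (c (r n) s)) \<longlonglongrightarrow> (\<Sum>s\<in>S. inner (c' s) (c' s))"
    by (intro tendsto_sum lim)
  moreover have "(\<Sum>s\<in>S. inner (c (r n) s) (c (r n) s)) = 2" for n
    using c2[of "r n"] by (simp add: power2_norm_eq_inner)
  ultimately have "(\<Sum>s\<in>S. inner (c' s) (c' s)) = 2" by (simp add: LIMSEQ_const_iff)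
  then have c': "c' \<in> normalized_cocycles G S"
    using \<rho> by (auto simp: normalized_cocycles_def power2_norm_eq_inner)
  have "(\<lambda>n. (norm (\<Sum>s\<in>S. c (r n) s))\<^sup>2) \<longlonglongrightarrow> (norm (\<Sum>s\<in>S. c' s))\<^sup>2"
    unfolding power2_norm_eq_inner inner_sum_left inner_sum_right by (intro tendsto_sum lim)
  moreover have "(\<lambda>n. l + 1 / real (Suc (r n))) \<longlonglongrightarrow> l + 0"
    using LIMSEQ_subseq_LIMSEQ[OF LIMSEQ_inverse_real_of_nat r]
    by (intro tendsto_intros) (simp add: o_def inverse_eq_divide)
  ultimately have "(norm (\<Sum>s\<in>S. c' s))\<^sup>2 \<le> l + 0"
    by (rule LIMSEQ_le) (use c_lt less_imp_le in blast)
  then have "ereal ((norm (\<Sum>s\<in>S. c' s))\<^sup>2) \<le> spectral_gap G S" by (simp add: l)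
  with spectral_gap_le[OF c'] c' show ?thesis by (intro bexI[of _ c']) auto
qed

text \<open>The coboundary of a unit vector of the regular representation, which is obtained here from the
  identity matrix as kernel.\<close>

lemma normalized_cocycles_nonempty:
  assumes nontrivial: "carrier G \<noteq> {\<one>}"
  shows "(normalized_cocycles G S :: ('g \<Rightarrow> real ell2) set) \<noteq> {}"
proof -
  have "\<exists>s\<in>S. s \<noteq> \<one>"
  proof (rule ccontr)
    assume "\<not> (\<exists>s\<in>S. s \<noteq> \<one>)"
    then have "S \<subseteq> {\<one>}" by auto
    have "g \<in> {\<one>}" if "g \<in> generate G S" for g
      using that
    proof (induction rule: generate.induct)
      case (incl h)
      then show ?case using \<open>S \<subseteq> {\<one>}\<close> by blast
    next
      case (inv h)
      then have "h = \<one>" using \<open>S \<subseteq> {\<one>}\<close> by blast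
      then show ?case by simp
    qed simp_all
    then have "carrier G \<subseteq> {\<one>}" unfolding generate_S by (rule subsetI)
    then show False using nontrivial one_closed by blast
  qed
  then obtain s where s: "s \<in> S" "s \<noteq> \<one>" by blast
  obtain e :: "nat \<Rightarrow> 'g" where e: "range e = carrier G" by (rule carrier_enumeration)
  define K where "K g h = (if g = h then 1 else 0 :: real)" for g h :: 'g
  have psd: "psd (\<lambda>m n. K (e m) (e n))"
  proof -
    have "inv_into UNIV e (e m) = inv_into UNIV e (e n) \<longleftrightarrow> e m = e n" for m n
      by (metis f_inv_into_f rangeI)
    then have "(\<lambda>m n. K (e m) (e n))
        = (\<lambda>m n. inner (unit_vector (inv_into UNIV e (e m))) (unit_vector (inv_into UNIV e (e n))))"
      by (simp add: inner_unit_vector K_def)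
    then show ?thesis by (simp only: psd_gram)
  qed
  have K_inv: "K (k \<otimes> g) (k \<otimes> h) = K g h"
    if "k \<in> carrier G" "g \<in> carrier G" "h \<in> carrier G" for k g h
    using that by (simp add: K_def)
  obtain \<rho> and w :: "'g \<Rightarrow> real ell2" where \<rho>: "orthogonal_rep G \<rho>"
    and w: "\<And>g h. g \<in> carrier G \<Longrightarrow> h \<in> carrier G \<Longrightarrow> inner (w g) (w h) = K g h"
      "\<And>g h. g \<in> carrier G \<Longrightarrow> h \<in> carrier G \<Longrightarrow> blinfun_apply (\<rho> g) (w h) = w (g \<otimes> h)"
    by (rule gns_construction[where act = "(\<otimes>)" and K = K,
          OF is_group e[symmetric] psd m_closed l_one m_assoc K_inv]; (assumption | rule that))
  have sG: "s \<in> carrier G" using s S_subset by blast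
  have "\<rho> s (w \<one>) - w \<one> = w s - w \<one>" using w(2)[OF sG one_closed] sG by simp
  then have "(norm (\<rho> s (w \<one>) - w \<one>))\<^sup>2 = 2"
    unfolding power2_norm_eq_inner using sG s(2) by (simp add: inner_diff_left inner_diff_right w(1) K_def)
  moreover have "(norm (\<rho> s (w \<one>) - w \<one>))\<^sup>2 \<le> (\<Sum>s\<in>S. (norm (\<rho> s (w \<one>) - w \<one>))\<^sup>2)"
    by (rule member_le_sum) (use s finite_S in auto)
  ultimately have "0 < (\<Sum>s\<in>S. (norm (\<rho> s (w \<one>) - w \<one>))\<^sup>2)" by simp
  from normalized_coboundary[OF \<rho> this] show ?thesis by blast
qed

end

theorem theorem3p5:
  fixes G :: "('g, 'm) monoid_scheme" (structure) and S :: "'g set"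
  assumes "group G"
    and "finite S" and "S \<subseteq> carrier G" and "(\<lambda>s. inv s) ` S = S" and "generate G S = carrier G"
  shows "(INF c \<in> (normalized_cocycles G S :: ('g \<Rightarrow> real ell2) set).
            ereal ((norm (\<Sum>s\<in>S. c s))\<^sup>2)) = spectral_gap G S
    \<and> (\<forall>c \<in> (normalized_cocycles G S :: ('g \<Rightarrow> 'h::{real_inner, complete_space}) set).
            spectral_gap G S \<le> ereal ((norm (\<Sum>s\<in>S. c s))\<^sup>2))
    \<and> (carrier G \<noteq> {\<one>} \<longrightarrow>
         (\<exists>c \<in> (normalized_cocycles G S :: ('g \<Rightarrow> real ell2) set).
            ereal ((norm (\<Sum>s\<in>S. c s))\<^sup>2) = spectral_gap G S))"
proof (intro conjI ballI impI)
  interpret group G by fact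
  interpret finite_symmetric_generating_set G S
    by unfold_locales (fact assms)+
  note le = spectral_gap_le and attained = spectral_gap_attained
  show "(INF c \<in> (normalized_cocycles G S :: ('g \<Rightarrow> real ell2) set).
            ereal ((norm (\<Sum>s\<in>S. c s))\<^sup>2)) = spectral_gap G S" (is "?inf = _")
  proof (rule antisym)
    show "spectral_gap G S \<le> ?inf" by (intro INF_greatest le)
    show "?inf \<le> spectral_gap G S"
    proof (cases "spectral_gap G S < \<infinity>")
      case True
      then obtain c :: "'g \<Rightarrow> real ell2" where "c \<in> normalized_cocycles G S"
        "ereal ((norm (\<Sum>s\<in>S. c s))\<^sup>2) = spectral_gap G S" using attained by blast
      then show ?thesis by (metis INF_lower)
    next
      case False
      then show ?thesis by simp
    qed
  qed
  show "spectral_gap G S \<le> ereal ((norm (\<Sum>s\<in>S. c s))\<^sup>2)"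
    if "c \<in> (normalized_cocycles G S :: ('g \<Rightarrow> 'h) set)" for c
    using that by (rule le)
  assume "carrier G \<noteq> {\<one>}"
  then obtain c :: "'g \<Rightarrow> real ell2" where "c \<in> normalized_cocycles G S"
    using normalized_cocycles_nonempty by blast
  from le[OF this] have "spectral_gap G S < \<infinity>" by auto
  then show "\<exists>c \<in> (normalized_cocycles G S :: ('g \<Rightarrow> real ell2) set).
      ereal ((norm (\<Sum>s\<in>S. c s))\<^sup>2) = spectral_gap G S" by (rule attained)
qed

end
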